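(* Let $0<s<t<1$ and let $N$ be the absolute normalised norm on $\mathbb{R}^2$ defined by \[N(a,b)=\max\{s|a|+|b|,\ |a|+t|b|\}.\] Let $D$ be a real Banach space with the Daugavet property and let $X=D\oplus_N D$. Then \[T(X)=1+t\qquad\text{and}\qquad T(X\oplus_1 X)=\frac{2(1-st)}{2-s-t}.\] In particular, $T(X\oplus_1 X)<T(X)$.
   Context: All Banach spaces are real and nonzero. For a Banach space $X$, $B_X$ and $S_X$ denote its closed unit ball and unit sphere, and $B(x,r)$ is the ball with centre $x$ and radius $r$. A subset $W\subset B_X$ is relatively weakly open if it is the intersection of $B_X$ with a weakly open subset of $X$. The Daugavet index of thickness of $X$ is \[T(X)=\inf\{r>0 : \text{there are } x\in S_X \text{ and a non-empty relatively weakly open } W\subset B_X \text{ such that } W\subset B(x,r)\}.\] A Banach space $X$ has the Daugavet property if $\|I+R\|=1+\|R\|$ for every rank-one bounded linear operator $R\colon X\to X$; this is equivalent to $T(X)=2$. If $X$ has the Daugavet property then for every $x\in S_X$, every non-empty relatively weakly open subset $U$ of $B_X$ and every $\varepsilon>0$ there is $u\in U$ with $\|x-u\|>2-\varepsilon$. A norm $N$ on $\mathbb{R}^2$ is absolute if $N(a,b)=N(|a|,|b|)$ for all $(a,b)\in\mathbb{R}^2$, and normalised if $N(1,0)=N(0,1)=1$. For Banach spaces $X,Y$, $X\oplus_N Y$ is the space $X\times Y$ with the norm $\|(x,y)\|=N(\|x\|,\|y\|)$, and $X\oplus_1 Y$ is $X\times Y$ with the norm $\|(x,y)\|=\|x\|+\|y\|$.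 *)

theory Defs
  imports "HOL-Analysis.Analysis"
begin

text \<open>
  The norms of the direct sums depend on the real parameters \<open>s\<close> and \<open>t\<close>, so these sums are not
  instances of the class of normed spaces. A normed space is therefore given as a real vector
  space (a type) together with its norm as an explicit function \<open>\<nu>\<close>.
\<close>

definition is_norm :: "('a::real_vector \<Rightarrow> real) \<Rightarrow> bool" where
  "is_norm \<nu> \<longleftrightarrow> (\<forall>x. 0 \<le> \<nu> x) \<and> (\<forall>x. \<nu> x = 0 \<longleftrightarrow> x = 0)
     \<and> (\<forall>x y. \<nu> (x + y) \<le> \<nu> x + \<nu> y) \<and> (\<forall>c x. \<nu> (c *\<^sub>R x) = \<bar>c\<bar> * \<nu> x)"

definition dual_functional :: "('a::real_vector \<Rightarrow> real) \<Rightarrow> ('a \<Rightarrow> real) \<Rightarrow> bool" where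
  "dual_functional \<nu> f \<longleftrightarrow> linear f \<and> (\<exists>K. \<forall>x. \<bar>f x\<bar> \<le> K * \<nu> x)"

definition weak_topology :: "('a::real_vector \<Rightarrow> real) \<Rightarrow> 'a topology" where
  "weak_topology \<nu> = topology_generated_by {f -` U | f U. dual_functional \<nu> f \<and> open U}"

definition unit_ball :: "('a::real_vector \<Rightarrow> real) \<Rightarrow> 'a set" where
  "unit_ball \<nu> = {x. \<nu> x \<le> 1}"

definition rel_weakly_open :: "('a::real_vector \<Rightarrow> real) \<Rightarrow> 'a set \<Rightarrow> bool" where
  "rel_weakly_open \<nu> W \<longleftrightarrow> openin (subtopology (weak_topology \<nu>) (unit_ball \<nu>)) W"

text \<open>
  The ball around \<open>x\<close> is taken closed; the infimum is the same for open balls. For a norm on a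
  nonzero space the infimum is over a nonempty set, since \<open>r = 2\<close> is always admissible.
\<close>

definition thickness :: "('a::real_vector \<Rightarrow> real) \<Rightarrow> real" where
  "thickness \<nu> = Inf {r. r > 0 \<and> (\<exists>x W. \<nu> x = 1 \<and> W \<noteq> {} \<and> rel_weakly_open \<nu> W
     \<and> W \<subseteq> {y. \<nu> (y - x) \<le> r})}"

definition daugavet_property :: "'a::banach itself \<Rightarrow> bool" where
  "daugavet_property (_ :: 'a itself) \<longleftrightarrow>
     (\<forall>R :: 'a \<Rightarrow> 'a. bounded_linear R \<and> dim (range R) = 1
        \<longrightarrow> onorm (\<lambda>x. x + R x) = 1 + onorm R)"

definition absolute :: "(real \<times> real \<Rightarrow> real) \<Rightarrow> bool" where
  "absolute N \<longleftrightarrow> (\<forall>a b. N (a, b) = N (\<bar>a\<bar>, \<bar>b\<bar>))"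

definition normalised :: "(real \<times> real \<Rightarrow> real) \<Rightarrow> bool" where
  "normalised N \<longleftrightarrow> N (1, 0) = 1 \<and> N (0, 1) = 1"

definition norm_sum ::
    "(real \<times> real \<Rightarrow> real) \<Rightarrow> ('a \<Rightarrow> real) \<Rightarrow> ('b \<Rightarrow> real) \<Rightarrow> 'a \<times> 'b \<Rightarrow> real" where
  "norm_sum N \<mu> \<nu> = (\<lambda>(x, y). N (\<mu> x, \<nu> y))"

definition norm_sum1 :: "('a \<Rightarrow> real) \<Rightarrow> ('b \<Rightarrow> real) \<Rightarrow> 'a \<times> 'b \<Rightarrow> real" where
  "norm_sum1 \<mu> \<nu> = (\<lambda>(x, y). \<mu> x + \<nu> y)"

definition N_st :: "real \<Rightarrow> real \<Rightarrow> real \<times> real \<Rightarrow> real" where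
  "N_st s t = (\<lambda>(a, b). max (s * \<bar>a\<bar> + \<bar>b\<bar>) (\<bar>a\<bar> + t * \<bar>b\<bar>))"

lemma is_norm_triangle: "is_norm \<nu> \<Longrightarrow> \<nu> (x + y) \<le> \<nu> x + \<nu> y"
  and is_norm_scale: "is_norm \<nu> \<Longrightarrow> \<nu> (c *\<^sub>R x) = \<bar>c\<bar> * \<nu> x"
  and is_norm_nonneg: "is_norm \<nu> \<Longrightarrow> 0 \<le> \<nu> x"
  by (simp_all add: is_norm_def)

lemma is_norm_norm: "is_norm (norm :: 'a::real_normed_vector \<Rightarrow> real)"
  by (simp add: is_norm_def norm_triangle_ineq)

lemma dual_functional_norm:
  "dual_functional norm f \<longleftrightarrow> bounded_linear (f :: 'a::real_normed_vector \<Rightarrow> real)"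
  unfolding dual_functional_def bounded_linear_def bounded_linear_axioms_def
  by (simp add: mult.commute)

lemma N_st_absolute_normalised_norm:
  assumes "0 < s" "s < t" "t < 1"
  shows "is_norm (N_st s t)" "absolute (N_st s t)" "normalised (N_st s t)"
proof -
  have tri: "N_st s t (p + q) \<le> N_st s t p + N_st s t q" for p q
  proof -
    obtain a b c d where [simp]: "p = (a, b)" "q = (c, d)"
      by (cases p, cases q) auto
    have "s * \<bar>a + c\<bar> \<le> s * (\<bar>a\<bar> + \<bar>c\<bar>)" "t * \<bar>b + d\<bar> \<le> t * (\<bar>b\<bar> + \<bar>d\<bar>)"
      using assms by (auto intro!: mult_left_mono)
    then have "s * \<bar>a + c\<bar> + \<bar>b + d\<bar> \<le> (s * \<bar>a\<bar> + \<bar>b\<bar>) + (s * \<bar>c\<bar> + \<bar>d\<bar>)"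
      "\<bar>a + c\<bar> + t * \<bar>b + d\<bar> \<le> (\<bar>a\<bar> + t * \<bar>b\<bar>) + (\<bar>c\<bar> + t * \<bar>d\<bar>)"
      using abs_triangle_ineq[of b d] abs_triangle_ineq[of a c] by (simp_all add: distrib_left)
    then show ?thesis
      unfolding N_st_def by (simp only: \<open>p = _\<close> \<open>q = _\<close> add_Pair prod.case) linarith
  qed
  have hom: "N_st s t (c *\<^sub>R p) = \<bar>c\<bar> * N_st s t p" for c p
    by (cases p) (simp add: N_st_def abs_mult max_mult_distrib_left distrib_left mult.left_commute)
  have nonneg: "0 \<le> N_st s t p" for p
    using assms by (cases p) (simp add: N_st_def le_max_iff_disj)
  have "p = 0" if "N_st s t p = 0" for p
  proof -
    obtain a b where p: "p = (a, b)" by (cases p)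
    have "s * \<bar>a\<bar> + \<bar>b\<bar> \<le> 0" "\<bar>a\<bar> + t * \<bar>b\<bar> \<le> 0"
      using that unfolding p N_st_def by (auto simp: max_def split: if_splits)
    moreover have "0 \<le> s * \<bar>a\<bar>" "0 \<le> t * \<bar>b\<bar>" using assms by auto
    ultimately have "\<bar>b\<bar> \<le> 0" "\<bar>a\<bar> \<le> 0" by linarith+
    then show ?thesis unfolding p by (simp add: zero_prod_def)
  qed
  moreover have "N_st s t 0 = 0" by (simp add: N_st_def zero_prod_def)
  ultimately show "is_norm (N_st s t)"
    using tri hom nonneg unfolding is_norm_def by blast
  show "absolute (N_st s t)" by (simp add: absolute_def N_st_def)
  show "normalised (N_st s t)" using assms by (simp add: normalised_def N_st_def)
qed

lemma is_norm_norm_sum1: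
  assumes "is_norm \<mu>" "is_norm \<nu>"
  shows "is_norm (norm_sum1 \<mu> \<nu>)"
  unfolding is_norm_def
proof (intro conjI allI)
  fix p q :: "'a \<times> 'b" and c :: real
  obtain x y x' y' where [simp]: "p = (x, y)" "q = (x', y')" by (cases p, cases q) auto
  note d = assms[unfolded is_norm_def]
  show "0 \<le> norm_sum1 \<mu> \<nu> p" using d by (simp add: norm_sum1_def)
  show "norm_sum1 \<mu> \<nu> p = 0 \<longleftrightarrow> p = 0"
    using d by (simp add: norm_sum1_def zero_prod_def add_nonneg_eq_0_iff)
  show "norm_sum1 \<mu> \<nu> (c *\<^sub>R p) = \<bar>c\<bar> * norm_sum1 \<mu> \<nu> p"
    using d by (simp add: norm_sum1_def distrib_left)
  have "\<mu> (x + x') \<le> \<mu> x + \<mu> x'" "\<nu> (y + y') \<le> \<nu> y + \<nu> y'" using d by blast+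
  then show "norm_sum1 \<mu> \<nu> (p + q) \<le> norm_sum1 \<mu> \<nu> p + norm_sum1 \<mu> \<nu> q"
    by (simp add: norm_sum1_def)
qed

lemma absolute_norm_mono:
  assumes N: "is_norm N" "absolute N" and ab: "\<bar>a\<bar> \<le> \<bar>a'\<bar>" "\<bar>b\<bar> \<le> \<bar>b'\<bar>"
  shows "N (a, b) \<le> N (a', b')"
proof -
  have conv: "N (u *\<^sub>R p + (1 - u) *\<^sub>R q) \<le> u * N p + (1 - u) * N q"
    if "0 \<le> u" "u \<le> 1" for u p q
  proof -
    have "N (u *\<^sub>R p + (1 - u) *\<^sub>R q) \<le> N (u *\<^sub>R p) + N ((1 - u) *\<^sub>R q)"
      by (rule is_norm_triangle[OF N(1)])
    also have "\<dots> = u * N p + (1 - u) * N q"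
      using is_norm_scale[OF N(1), of u p] is_norm_scale[OF N(1), of "1 - u" q] that by simp
    finally show ?thesis .
  qed
  have interp: "\<exists>u. 0 \<le> u \<and> u \<le> 1 \<and> x = u * y + (1 - u) * (- y)"
    if "\<bar>x\<bar> \<le> \<bar>y\<bar>" for x y :: real
  proof (cases "y = 0")
    case True
    then show ?thesis using that by (intro exI[of _ 0]) auto
  next
    case False
    have "\<bar>x / y\<bar> \<le> 1" using that False by simp
    then have "-1 \<le> x / y" "x / y \<le> 1" by linarith+
    moreover have "x = (1 + x / y) / 2 * y + (1 - (1 + x / y) / 2) * (- y)"
      using False by (simp add: field_simps)
    moreover have "0 \<le> (1 + x / y) / 2" "(1 + x / y) / 2 \<le> 1" using calculation by simp_all
    ultimately show ?thesis by blast
  qed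
  have neg: "N (- x, y) = N (x, y)" "N (x, - y) = N (x, y)" for x y
    using N(2)[unfolded absolute_def, rule_format, of "- x" y]
      N(2)[unfolded absolute_def, rule_format, of x "- y"]
      N(2)[unfolded absolute_def, rule_format, of x y] by simp_all
  obtain u where u: "0 \<le> u" "u \<le> 1" "a = u * a' + (1 - u) * (- a')" using interp ab by blast
  obtain v where v: "0 \<le> v" "v \<le> 1" "b = v * b' + (1 - v) * (- b')" using interp ab by blast
  have "u *\<^sub>R (a', b) + (1 - u) *\<^sub>R (- a', b) = (a, b)"
    by (simp add: u(3) algebra_simps)
  then have "N (a, b) \<le> N (a', b)"
    using conv[OF u(1,2), of "(a', b)" "(- a', b)"] by (simp add: neg algebra_simps)
  also have "v *\<^sub>R (a', b') + (1 - v) *\<^sub>R (a', - b') = (a', b)"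
    by (simp add: v(3) algebra_simps)
  then have "N (a', b) \<le> N (a', b')"
    using conv[OF v(1,2), of "(a', b')" "(a', - b')"] by (simp add: neg algebra_simps)
  finally show ?thesis .
qed

lemma is_norm_norm_sum:
  assumes N: "is_norm N" "absolute N" and dd: "is_norm \<mu>" "is_norm \<nu>"
  shows "is_norm (norm_sum N \<mu> \<nu>)"
  unfolding is_norm_def
proof (intro conjI allI)
  fix p q :: "'a \<times> 'b" and c :: real
  obtain x y x' y' where [simp]: "p = (x, y)" "q = (x', y')" by (cases p, cases q) auto
  note d = dd[unfolded is_norm_def] and n = N(1)[unfolded is_norm_def]
  show "0 \<le> norm_sum N \<mu> \<nu> p" using n by (simp add: norm_sum_def)
  show "norm_sum N \<mu> \<nu> p = 0 \<longleftrightarrow> p = 0"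
    using d n by (simp add: norm_sum_def zero_prod_def)
  have "N (\<bar>c\<bar> *\<^sub>R (\<mu> x, \<nu> y)) = \<bar>c\<bar> * N (\<mu> x, \<nu> y)" using is_norm_scale[OF N(1), of "\<bar>c\<bar>" "(\<mu> x, \<nu> y)"]
    by simp
  then show "norm_sum N \<mu> \<nu> (c *\<^sub>R p) = \<bar>c\<bar> * norm_sum N \<mu> \<nu> p"
    using d by (simp add: norm_sum_def)
  have "\<mu> (x + x') \<le> \<mu> x + \<mu> x'" "\<nu> (y + y') \<le> \<nu> y + \<nu> y'"
    "0 \<le> \<mu> (x + x')" "0 \<le> \<nu> (y + y')"
    using dd by (simp_all only: is_norm_triangle is_norm_nonneg)
  then have "N (\<mu> (x + x'), \<nu> (y + y')) \<le> N (\<mu> x + \<mu> x', \<nu> y + \<nu> y')"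
    by (intro absolute_norm_mono[OF N]) auto
  also have "\<dots> = N ((\<mu> x, \<nu> y) + (\<mu> x', \<nu> y'))" by simp
  also have "\<dots> \<le> N (\<mu> x, \<nu> y) + N (\<mu> x', \<nu> y')" by (rule is_norm_triangle[OF N(1)])
  finally show "norm_sum N \<mu> \<nu> (p + q) \<le> norm_sum N \<mu> \<nu> p + norm_sum N \<mu> \<nu> q"
    by (simp add: norm_sum_def)
qed

end

theory Submission
  imports Defs
begin

text \<open>
  In a space \<open>D\<close> with the Daugavet property, every weak neighbourhood of a point of the ball of
  radius \<open>\<rho>\<close> contains points of that ball whose distance to a given \<open>x\<close> is almost \<open>\<rho> + norm x\<close>
  (\<open>daugavet_weak_neighbourhood\<close>). The defining norm equation gives this for slices of the ball. A
  weak neighbourhood contains convex combinations of slices, by the Krein--Milman theorem applied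
  to images of the ball under finitely many functionals, and far points of the slices can be
  chosen one after the other. Adding the functionals one at a time keeps these images in the
  plane.

  In a direct sum of copies of \<open>D\<close> with an absolute norm the components can be moved independently
  (\<open>escapes_norm_sum\<close>). Only the profile of a vector matters, that is, the tuple of the norms of
  its components: if the centre has profile \<open>a\<close> and a relatively weakly open set contains a vector
  of profile at most \<open>r\<close>, where \<open>r\<close> is on the unit sphere, then the set contains points whose
  distance to the centre is almost the norm of the tuple \<open>a + r\<close>. So lower bounds for the index of
  thickness are inequalities for the norm of \<open>a + r\<close> over the nonnegative part of the unit sphere.

  The norm \<open>N_st s t\<close> is the maximum of the two functionals \<open>s * a + b\<close> and \<open>a + t * b\<close> on the
  quadrant. For one copy of the sum, two unit profiles have a sum of norm at least \<open>1 + t\<close>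
  (\<open>N_st_sphere_add\<close>). For the \<open>\<ell>\<^sub>1\<close>-sum of two copies the profiles of the components are no
  longer unit vectors, and the sharp inequality is \<open>N (u + v) \<ge> c * (N u + N v)\<close> with
  \<open>c = (1 - s * t) / (2 - s - t)\<close> (\<open>N_st_add_ge\<close>); adding it over the two summands gives \<open>2 * c\<close>.
  This is smaller because the weight can be distributed unequally, and in opposite ways, over the
  two summands.

  Both bounds are sharp. The extremal weakly open sets are cut out by functionals that force some
  of the components to be as large as the unit ball permits, which makes the remaining ones small.
  Such functionals exist by the Hahn--Banach theorem.
\<close>

section \<open>The Hahn--Banach theorem\<close>

definition sublinear :: "('a::real_vector \<Rightarrow> real) \<Rightarrow> bool" where
  "sublinear p \<longleftrightarrow> (\<forall>x y. p (x + y) \<le> p x + p y) \<and> (\<forall>c x. 0 \<le> c \<longrightarrow> p (c *\<^sub>R x) = c * p x)"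

lemma sublinear_add: "sublinear p \<Longrightarrow> p (x + y) \<le> p x + p y"
  and sublinear_scale: "sublinear p \<Longrightarrow> 0 \<le> c \<Longrightarrow> p (c *\<^sub>R x) = c * p x"
  by (simp_all add: sublinear_def)

lemma sublinear_zero: "sublinear p \<Longrightarrow> p 0 = 0"
  using sublinear_scale[of p 0 0] by simp

lemma sublinear_minus: "sublinear p \<Longrightarrow> - p (- x) \<le> p x"
  using sublinear_add[of p x "- x"] sublinear_zero[of p] by simp

lemma sublinear_norm: "sublinear (norm :: 'a::real_normed_vector \<Rightarrow> real)"
  by (simp add: sublinear_def norm_triangle_ineq)

text \<open>
  The greatest lower bound of the functionals \<open>x \<mapsto> p (x + t v) - t p v\<close>. It is sublinear, lies
  below \<open>p\<close>, and takes a value at most \<open>- p v\<close> at \<open>- v\<close>: it is \<open>p\<close> pushed down until it is linear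
  along \<open>v\<close>.
\<close>
definition lower_along :: "('a::real_vector \<Rightarrow> real) \<Rightarrow> 'a \<Rightarrow> 'a \<Rightarrow> real" where
  "lower_along p v x = (INF t\<in>{0..}. p (x + t *\<^sub>R v) - t * p v)"

lemma lower_along_le:
  assumes p: "sublinear p" and t: "0 \<le> t"
  shows "lower_along p v x \<le> p (x + t *\<^sub>R v) - t * p v"
  unfolding lower_along_def
proof (rule cINF_lower)
  show "bdd_below ((\<lambda>t. p (x + t *\<^sub>R v) - t * p v) ` {0..})"
  proof (rule bdd_belowI2[where m = "- p (- x)"])
    fix t :: real assume "t \<in> {0..}"
    then have "t * p v = p ((x + t *\<^sub>R v) + (- x))"
      using sublinear_scale[OF p, of t v] by simp
    also have "\<dots> \<le> p (x + t *\<^sub>R v) + p (- x)"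
      by (rule sublinear_add[OF p])
    finally show "- p (- x) \<le> p (x + t *\<^sub>R v) - t * p v"
      by simp
  qed
qed (use t in auto)

lemma lower_along_greatest:
  "(\<And>t. 0 \<le> t \<Longrightarrow> m \<le> p (x + t *\<^sub>R v) - t * p v) \<Longrightarrow> m \<le> lower_along p v x"
  unfolding lower_along_def by (rule cINF_greatest) auto

lemma sublinear_lower_along:
  assumes p: "sublinear p"
  shows "sublinear (lower_along p v)"
proof -
  let ?q = "lower_along p v"
  have add: "?q (x + y) \<le> ?q x + ?q y" for x y
  proof -
    have "?q (x + y) - (p (x + s *\<^sub>R v) - s * p v) \<le> p (y + t *\<^sub>R v) - t * p v"
      if "0 \<le> s" "0 \<le> t" for s t
    proof -
      have "?q (x + y) \<le> p ((x + s *\<^sub>R v) + (y + t *\<^sub>R v)) - (s + t) * p v"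
        using lower_along_le[OF p, of "s + t" v "x + y"] that by (simp add: algebra_simps)
      also have "\<dots> \<le> p (x + s *\<^sub>R v) + p (y + t *\<^sub>R v) - (s + t) * p v"
        using sublinear_add[OF p] by simp
      finally show ?thesis
        by (simp add: algebra_simps)
    qed
    then have "?q (x + y) - (p (x + s *\<^sub>R v) - s * p v) \<le> ?q y" if "0 \<le> s" for s
      by (intro lower_along_greatest) (use that in auto)
    then have "?q (x + y) - ?q y \<le> p (x + s *\<^sub>R v) - s * p v" if "0 \<le> s" for s
      using that by (simp add: algebra_simps)
    then have "?q (x + y) - ?q y \<le> ?q x"
      by (rule lower_along_greatest)
    then show ?thesis by simp
  qed
  have scale_le: "c * ?q x \<le> ?q (c *\<^sub>R x)" if c: "0 < c" for c x
  proof (rule lower_along_greatest)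
    fix t :: real assume "0 \<le> t"
    then have "c * ?q x \<le> c * (p (x + (t / c) *\<^sub>R v) - t / c * p v)"
      using c by (intro mult_left_mono lower_along_le[OF p]) auto
    also have "\<dots> = p (c *\<^sub>R (x + (t / c) *\<^sub>R v)) - t * p v"
      unfolding sublinear_scale[OF p less_imp_le[OF c]] using c by (simp add: field_simps)
    also have "c *\<^sub>R (x + (t / c) *\<^sub>R v) = c *\<^sub>R x + t *\<^sub>R v"
      using c by (simp add: algebra_simps)
    finally show "c * ?q x \<le> p (c *\<^sub>R x + t *\<^sub>R v) - t * p v" .
  qed
  have scale: "?q (c *\<^sub>R x) = c * ?q x" if "0 \<le> c" for c x
  proof (cases "c = 0")
    case True
    have "?q 0 = 0"
    proof (rule antisym)
      show "?q 0 \<le> 0"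
        using lower_along_le[OF p, of 0 v 0] sublinear_zero[OF p] by simp
      show "0 \<le> ?q 0"
        by (rule lower_along_greatest) (simp add: sublinear_scale[OF p])
    qed
    then show ?thesis using True by simp
  next
    case False
    then have c: "0 < c" using that by simp
    have "(1 / c) * ?q (c *\<^sub>R x) \<le> ?q x"
      using scale_le[of "1 / c" "c *\<^sub>R x"] c by simp
    then have "?q (c *\<^sub>R x) \<le> c * ?q x"
      using c by (simp add: field_simps)
    then show ?thesis using scale_le[OF c, of x] by simp
  qed
  show ?thesis
    unfolding sublinear_def using add scale by blast
qed

lemma lower_along_le_self: "sublinear p \<Longrightarrow> lower_along p v x \<le> p x"
  using lower_along_le[of p 0 v x] by simp

lemma lower_along_minus: "sublinear p \<Longrightarrow> lower_along p v (- v) \<le> - p v"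
  using lower_along_le[of p 1 v "- v"] sublinear_zero[of p] by simp

text \<open>
  Pushing a minimal \<open>p\<close> down along any \<open>v\<close> changes nothing, so \<open>p (- v) \<le> - p v\<close> for every \<open>v\<close>; an
  odd sublinear functional is linear.
\<close>
lemma minimal_sublinear_linear:
  assumes p: "sublinear p"
    and minimal: "\<And>q. sublinear q \<Longrightarrow> (\<And>x. q x \<le> p x) \<Longrightarrow> q = p"
  shows "linear p"
proof -
  have odd: "p (- x) = - p x" for x
  proof -
    have "lower_along p x = p"
      by (intro minimal sublinear_lower_along lower_along_le_self p)
    then have "p (- x) \<le> - p x"
      using lower_along_minus[OF p, of x] by simp
    then show ?thesis
      using sublinear_minus[OF p, of x] by simp
  qed
  show ?thesis
  proof (rule linearI)
    fix x y
    have "p (- x + - y) \<le> p (- x) + p (- y)"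
      by (rule sublinear_add[OF p])
    then have "p x + p y \<le> p (x + y)"
      using odd[of "x + y"] odd[of x] odd[of y] by simp
    then show "p (x + y) = p x + p y"
      using sublinear_add[OF p, of x y] by simp
  next
    fix c x
    show "p (c *\<^sub>R x) = c *\<^sub>R p x"
    proof (cases "0 \<le> c")
      case True
      then show ?thesis by (simp add: sublinear_scale[OF p])
    next
      case False
      then have "p ((- c) *\<^sub>R x) = - c * p x"
        by (intro sublinear_scale[OF p]) simp
      then show ?thesis using odd[of "c *\<^sub>R x"] by simp
    qed
  qed
qed

text \<open>
  Chains have lower bounds, as Zorn's lemma needs. The values at \<open>x\<close> are bounded below by
  \<open>- p0 (- x)\<close>, and of two members of a chain the smaller one bounds both sides of the triangle
  inequality.
\<close>
lemma sublinear_Inf_chain: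
  assumes ne: "C \<noteq> {}" and sub: "\<And>p. p \<in> C \<Longrightarrow> sublinear p"
    and le: "\<And>p x. p \<in> C \<Longrightarrow> p x \<le> p0 x"
    and chain: "\<And>p q. p \<in> C \<Longrightarrow> q \<in> C \<Longrightarrow> (\<forall>x. p x \<le> q x) \<or> (\<forall>x. q x \<le> p x)"
  shows "sublinear (\<lambda>x. INF p\<in>C. p x)" "\<And>p x. p \<in> C \<Longrightarrow> (INF p\<in>C. p x) \<le> p x"
proof -
  have bdd: "bdd_below ((\<lambda>p. p x) ` C)" for x
  proof (rule bdd_belowI2)
    fix p assume "p \<in> C"
    then show "- p0 (- x) \<le> p x"
      using sublinear_minus[OF sub, of p x] le[of p "- x"] by simp
  qed
  show lower: "(INF p\<in>C. p x) \<le> p x" if "p \<in> C" for p x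
    by (rule cINF_lower[OF bdd that])
  let ?q = "\<lambda>x. INF p\<in>C. p x"
  have add: "?q (x + y) \<le> ?q x + ?q y" for x y
  proof -
    have pq: "?q (x + y) \<le> p x + q y" if "p \<in> C" "q \<in> C" for p q
    proof (cases "\<forall>x. p x \<le> q x")
      case True
      have "?q (x + y) \<le> p x + p y"
        using lower[OF that(1), of "x + y"] sublinear_add[OF sub[OF that(1)], of x y] by simp
      also have "\<dots> \<le> p x + q y" using True by simp
      finally show ?thesis .
    next
      case False
      have "?q (x + y) \<le> q x + q y"
        using lower[OF that(2), of "x + y"] sublinear_add[OF sub[OF that(2)], of x y] by simp
      also have "\<dots> \<le> p x + q y" using False chain[OF that] by auto
      finally show ?thesis .
    qed
    have "?q (x + y) - p x \<le> ?q y" if "p \<in> C" for p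
      by (rule cINF_greatest[OF ne]) (use pq[OF that] in \<open>simp add: algebra_simps\<close>)
    then have "?q (x + y) - ?q y \<le> ?q x"
      by (intro cINF_greatest[OF ne]) (simp add: algebra_simps)
    then show ?thesis by simp
  qed
  have scale_le: "c * ?q x \<le> ?q (c *\<^sub>R x)" if "0 \<le> c" for c x
  proof (rule cINF_greatest[OF ne])
    fix p assume "p \<in> C"
    then show "c * ?q x \<le> p (c *\<^sub>R x)"
      using that lower[of p x] by (simp add: sublinear_scale[OF sub] mult_left_mono)
  qed
  have scale: "?q (c *\<^sub>R x) = c * ?q x" if "0 \<le> c" for c x
  proof (cases "c = 0")
    case True
    have "?q 0 = (INF p\<in>C. 0)"
      by (rule INF_cong) (simp_all add: sublinear_zero[OF sub])
    then show ?thesis using True ne by simp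
  next
    case False
    then have "(1 / c) * ?q (c *\<^sub>R x) \<le> ?q x"
      using scale_le[of "1 / c" "c *\<^sub>R x"] that by simp
    then have "?q (c *\<^sub>R x) \<le> c * ?q x"
      using that False by (simp add: field_simps)
    then show ?thesis using scale_le[OF that, of x] by simp
  qed
  show "sublinear ?q"
    unfolding sublinear_def using add scale by blast
qed

text \<open>
  The Hahn--Banach theorem in its order-theoretic form: by Zorn's lemma there is a minimal
  sublinear functional below \<open>p0\<close>. This minimal functional is linear.
\<close>
theorem Hahn_Banach_sublinear:
  assumes p0: "sublinear p0"
  shows "\<exists>f. linear f \<and> (\<forall>x. f x \<le> p0 x)"
proof -
  define A where "A = {p. sublinear p \<and> (\<forall>x. p x \<le> p0 x)}"
  \<comment> \<open>The order is reversed, since Zorn's lemma yields maximal elements.\<close>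
  define P where "P = (\<lambda>(p :: 'a \<Rightarrow> real) q. \<forall>x. q x \<le> p x)"
  have po: "partial_order_on A (relation_of P A)"
    unfolding P_def
  proof (rule partial_order_on_relation_ofI)
    fix p q :: "'a \<Rightarrow> real"
    assume "\<forall>x. q x \<le> p x" "\<forall>x. p x \<le> q x"
    then show "p = q" by (simp add: fun_eq_iff order_antisym)
  qed (auto intro: order_trans)
  have "\<exists>m\<in>A. \<forall>a\<in>A. P m a \<longrightarrow> a = m"
  proof (rule predicate_Zorn[OF po])
    fix C assume C: "C \<in> Chains (relation_of P A)"
    show "\<exists>u\<in>A. \<forall>a\<in>C. P a u"
    proof (cases "C = {}")
      case True
      then show ?thesis using p0 by (auto simp: A_def)
    next
      case False
      have CA: "C \<subseteq> A" and chain: "\<And>p q. p \<in> C \<Longrightarrow> q \<in> C \<Longrightarrow> (\<forall>x. p x \<le> q x) \<or> (\<forall>x. q x \<le> p x)"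
        using C unfolding Chains_def relation_of_def P_def by blast+
      have le: "p x \<le> p0 x" if "p \<in> C" for p x
        using CA that unfolding A_def by blast
      have sub: "sublinear p" if "p \<in> C" for p
        using CA that unfolding A_def by blast
      have inf: "sublinear (\<lambda>x. INF p\<in>C. p x)" "\<And>p x. p \<in> C \<Longrightarrow> (INF p\<in>C. p x) \<le> p x"
        using sublinear_Inf_chain[where C = C and ?p0.0 = p0] False sub le chain by blast+
      obtain p where "p \<in> C" using False by blast
      then have "(INF p\<in>C. p x) \<le> p0 x" for x
        using inf(2)[OF \<open>p \<in> C\<close>, of x] le[OF \<open>p \<in> C\<close>, of x] by simp
      then show ?thesis
        using inf by (intro bexI[of _ "\<lambda>x. INF p\<in>C. p x"]) (auto simp: A_def P_def)
    qed
  qed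
  then obtain m where m: "m \<in> A" "\<And>a. a \<in> A \<Longrightarrow> P m a \<Longrightarrow> a = m" by blast
  have "linear m"
  proof (rule minimal_sublinear_linear)
    show "sublinear m" using m(1) by (simp add: A_def)
    fix q assume "sublinear q" "\<And>x. q x \<le> m x"
    then have "q \<in> A" "P m q"
      using m(1) by (auto simp: A_def P_def intro: order_trans)
    then show "q = m" by (rule m(2))
  qed
  then show ?thesis using m(1) by (auto simp: A_def)
qed

text \<open>
  Starting from the norm already pushed down along \<open>e\<close> forces the value at \<open>- e\<close> to be \<open>- norm e\<close>.
\<close>
corollary norming_functional:
  fixes e :: "'a::real_normed_vector"
  shows "\<exists>f. linear f \<and> (\<forall>x. \<bar>f x\<bar> \<le> norm x) \<and> f e = norm e"
proof -
  obtain f where f: "linear f" "\<And>x. f x \<le> lower_along norm e x"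
    using Hahn_Banach_sublinear[OF sublinear_lower_along[OF sublinear_norm]] by blast
  have le: "f x \<le> norm x" for x
    using f(2)[of x] lower_along_le_self[OF sublinear_norm, of e x] by simp
  have "\<bar>f x\<bar> \<le> norm x" for x
    using le[of x] le[of "- x"] linear_neg[OF f(1), of x] by simp
  moreover have "f (- e) \<le> - norm e"
    using f(2)[of "- e"] lower_along_minus[OF sublinear_norm, of e] by simp
  then have "f e = norm e"
    using le[of e] linear_neg[OF f(1), of e] by simp
  ultimately show ?thesis using f(1) by blast
qed

section \<open>Weak neighbourhoods in spaces with the Daugavet property\<close>

text \<open>
  For \<open>y\<close> in the unit ball \<open>norm (x + y) \<le> norm x + 1\<close>, and a far reaching subset of the ball
  comes arbitrarily close to this bound for every \<open>x\<close>. Quantifying over all \<open>x\<close> and not only over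
  the unit sphere is what makes the property pass to convex combinations of sets.
\<close>
definition far_reaching :: "'a::real_normed_vector set \<Rightarrow> bool" where
  "far_reaching S \<longleftrightarrow> (\<forall>x. \<forall>\<epsilon>>0. \<exists>y\<in>S. norm x + 1 - \<epsilon> < norm (x + y))"

lemma far_reachingD:
  "far_reaching S \<Longrightarrow> 0 < \<epsilon> \<Longrightarrow> \<exists>y\<in>S. norm x + 1 - \<epsilon> < norm (x + y)"
  by (simp add: far_reaching_def)

lemma far_reaching_mono: "far_reaching S \<Longrightarrow> S \<subseteq> T \<Longrightarrow> far_reaching T"
  unfolding far_reaching_def by blast

lemma far_reaching_scaled:
  assumes S: "far_reaching S" and c: "0 \<le> c" and \<epsilon>: "0 < \<epsilon>"
  shows "\<exists>y\<in>S. norm x + c - \<epsilon> < norm (x + c *\<^sub>R y)"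
proof (cases "c = 0")
  case True
  then show ?thesis using far_reachingD[OF S, of 1 0] \<epsilon> by auto
next
  case False
  then have c: "0 < c" using c by simp
  obtain y where y: "y \<in> S" "norm (x /\<^sub>R c) + 1 - \<epsilon> / c < norm (x /\<^sub>R c + y)"
    using far_reachingD[OF S, of "\<epsilon> / c" "x /\<^sub>R c"] c \<epsilon> by auto
  have "c * (norm (x /\<^sub>R c) + 1 - \<epsilon> / c) < c * norm (x /\<^sub>R c + y)"
    using y(2) c by simp
  also have "c * norm (x /\<^sub>R c + y) = norm (c *\<^sub>R (x /\<^sub>R c + y))"
    using c by simp
  also have "c *\<^sub>R (x /\<^sub>R c + y) = x + c *\<^sub>R y"
    using c by (simp add: scaleR_add_right)
  also have "c * (norm (x /\<^sub>R c) + 1 - \<epsilon> / c) = norm x + c - \<epsilon>"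
    using c by (simp add: algebra_simps)
  finally have "norm x + c - \<epsilon> < norm (x + c *\<^sub>R y)" .
  then show ?thesis using y(1) by blast
qed

text \<open>
  The points are chosen one after the other, each with respect to the sum of \<open>x\<close> and the
  previously chosen terms.
\<close>
lemma far_reaching_combination:
  assumes "finite I" and "\<And>i. i \<in> I \<Longrightarrow> 0 \<le> c i" and "\<And>i. i \<in> I \<Longrightarrow> far_reaching (S i)"
    and "0 < \<epsilon>"
  shows "\<exists>y. (\<forall>i\<in>I. y i \<in> S i) \<and> norm x + sum c I - \<epsilon> < norm (x + (\<Sum>i\<in>I. c i *\<^sub>R y i))"
  using assms
proof (induction arbitrary: \<epsilon> rule: finite_induct)
  case empty
  then show ?case by simp
next
  case (insert j I)
  obtain y where y: "\<forall>i\<in>I. y i \<in> S i"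
    "norm x + sum c I - \<epsilon> / 2 < norm (x + (\<Sum>i\<in>I. c i *\<^sub>R y i))"
    using insert.IH[of "\<epsilon> / 2"] insert.prems by auto
  let ?z = "x + (\<Sum>i\<in>I. c i *\<^sub>R y i)"
  obtain u where u: "u \<in> S j" "norm ?z + c j - \<epsilon> / 2 < norm (?z + c j *\<^sub>R u)"
    using far_reaching_scaled[of "S j" "c j" "\<epsilon> / 2" ?z] insert.prems by auto
  have "(\<Sum>i\<in>I. c i *\<^sub>R (y(j := u)) i) = (\<Sum>i\<in>I. c i *\<^sub>R y i)"
    using insert.hyps by (intro sum.cong) auto
  then have "x + (\<Sum>i\<in>insert j I. c i *\<^sub>R (y(j := u)) i) = ?z + c j *\<^sub>R u"
    using insert.hyps by (simp add: algebra_simps)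
  moreover have "norm x + sum c (insert j I) - \<epsilon> < norm (?z + c j *\<^sub>R u)"
    using y(2) u(2) insert.hyps by simp
  moreover have "\<forall>i\<in>insert j I. (y(j := u)) i \<in> S i"
    using y(1) u(1) by simp
  ultimately show ?case by metis
qed

lemma extreme_point_not_in_hull_rest:
  assumes e: "e extreme_point_of K" and K: "convex K" and L: "L \<subseteq> K" "e \<notin> L"
  shows "e \<notin> convex hull L"
proof
  assume "e \<in> convex hull L"
  moreover have "convex hull L \<subseteq> K"
    using L(1) K by (rule hull_minimal)
  ultimately have "e extreme_point_of (convex hull L)"
    using e unfolding extreme_point_of_def by blast
  then show False using extreme_point_of_convex_hull L(2) by blast
qed

text \<open>
  Slices (intersections with open half-spaces) form a neighbourhood base at an extreme point \<open>e\<close>: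
  by compactness the convex hull of the part of \<open>K\<close> away from \<open>e\<close> is closed, and by extremality it
  misses \<open>e\<close>, so a hyperplane separates the two.
\<close>
lemma extreme_point_slice:
  fixes K :: "'e::euclidean_space set"
  assumes K: "compact K" "convex K" and e: "e extreme_point_of K" and r: "0 < r"
  obtains a \<beta> where "\<beta> < a \<bullet> e" "\<And>k. k \<in> K \<Longrightarrow> \<beta> < a \<bullet> k \<Longrightarrow> dist k e < r"
proof -
  let ?H = "convex hull (K - ball e r)"
  have "compact ?H"
    by (intro compact_convex_hull compact_diff K open_ball)
  moreover have "e \<notin> ?H"
    by (rule extreme_point_not_in_hull_rest[OF e K(2)]) (use r in auto)
  ultimately obtain a b where ab: "a \<bullet> e < b" "\<And>h. h \<in> ?H \<Longrightarrow> b < a \<bullet> h"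
    using separating_hyperplane_closed_point[of ?H e] compact_imp_closed by blast
  show ?thesis
  proof (rule that[of "- b" "- a"])
    show "- b < - a \<bullet> e" using ab(1) by simp
    fix k assume k: "k \<in> K" "- b < - a \<bullet> k"
    then have "k \<notin> ?H" using ab(2)[of k] by auto
    then have "k \<notin> K - ball e r" using hull_inc by metis
    then show "dist k e < r" using k(1) by (auto simp: dist_commute)
  qed
qed

definition slices_far_reaching :: "'a::real_normed_vector set \<Rightarrow> bool" where
  "slices_far_reaching C \<longleftrightarrow> (\<forall>h \<beta>. bounded_linear h \<longrightarrow> (\<exists>y\<in>C. \<beta> < h y)
     \<longrightarrow> far_reaching {y \<in> C. \<beta> < (h y :: real)})"

lemma slices_far_reachingD:
  "slices_far_reaching C \<Longrightarrow> bounded_linear h \<Longrightarrow> y \<in> C \<Longrightarrow> \<beta> < h y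
    \<Longrightarrow> far_reaching {y \<in> C. \<beta> < (h y :: real)}"
  unfolding slices_far_reaching_def by blast

text \<open>
  The closure \<open>K\<close> of \<open>T ` C\<close> is compact and convex, so \<open>T y0\<close> is a convex combination of extreme
  points of \<open>K\<close>. Small slices of \<open>K\<close> around these extreme points pull back to slices of \<open>C\<close>, and
  the same convex combination of those slices is far reaching, lies in \<open>C\<close>, and is mapped by \<open>T\<close>
  close to \<open>T y0\<close>.
\<close>
lemma far_reaching_preimage:
  fixes T :: "'a::real_normed_vector \<Rightarrow> 'e::euclidean_space"
  assumes C: "convex C" "bounded C" "slices_far_reaching C"
    and T: "bounded_linear T" and V: "open V" and y0: "y0 \<in> C" "T y0 \<in> V"
  shows "far_reaching {y \<in> C. T y \<in> V}"
proof -
  define K where "K = closure (T ` C)"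
  have K: "compact K" "convex K"
    unfolding K_def using C T
    by (auto intro!: convex_closure convex_linear_image bounded_linear_image
        simp: compact_closure bounded_linear.linear)
  obtain r where r: "0 < r" "ball (T y0) r \<subseteq> V"
    using V y0(2) open_contains_ball by metis
  have TK: "T y \<in> K" if "y \<in> C" for y
    unfolding K_def by (rule subsetD[OF closure_subset imageI[OF that]])
  have "T y0 \<in> K" by (rule TK[OF y0(1)])
  then have "T y0 \<in> convex hull {x. x extreme_point_of K}"
    using subsetD[OF equalityD1[OF Krein_Milman_Minkowski[OF K]]] by blast
  then obtain E c where E: "finite E" "\<And>e. e \<in> E \<Longrightarrow> e extreme_point_of K"
      "\<And>e. e \<in> E \<Longrightarrow> 0 \<le> c e" "sum c E = 1" "(\<Sum>e\<in>E. c e *\<^sub>R e) = T y0"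
    unfolding convex_hull_explicit by blast
  have "\<exists>S. S \<subseteq> C \<and> far_reaching S \<and> (\<forall>y\<in>S. dist (T y) e < r / 2)" if e: "e \<in> E" for e
  proof -
    obtain a \<beta> where ab: "\<beta> < a \<bullet> e" "\<And>k. k \<in> K \<Longrightarrow> \<beta> < a \<bullet> k \<Longrightarrow> dist k e < r / 2"
      using extreme_point_slice[OF K E(2)[OF e] half_gt_zero[OF r(1)]] by blast
    have "e \<in> closure (T ` C)"
      using E(2)[OF e] by (simp add: extreme_point_of_def K_def)
    moreover have "open {z. \<beta> < a \<bullet> z}"
      by (rule open_halfspace_gt)
    ultimately have "{z. \<beta> < a \<bullet> z} \<inter> T ` C \<noteq> {}"
      using open_Int_closure_eq_empty[of "{z. \<beta> < a \<bullet> z}" "T ` C"] ab(1) by blast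
    then have "\<exists>y\<in>C. \<beta> < a \<bullet> T y" by blast
    moreover have "bounded_linear (\<lambda>y. a \<bullet> T y)"
      by (rule bounded_linear_compose[OF bounded_linear_inner_right T])
    ultimately have "far_reaching {y \<in> C. \<beta> < a \<bullet> T y}"
      using C(3) unfolding slices_far_reaching_def by blast
    then show ?thesis
      using ab(2) TK by (intro exI[of _ "{y \<in> C. \<beta> < a \<bullet> T y}"]) auto
  qed
  then obtain S where S: "\<And>e. e \<in> E \<Longrightarrow> S e \<subseteq> C" "\<And>e. e \<in> E \<Longrightarrow> far_reaching (S e)"
      "\<And>e y. e \<in> E \<Longrightarrow> y \<in> S e \<Longrightarrow> dist (T y) e < r / 2"
    by metis
  show ?thesis
    unfolding far_reaching_def
  proof (intro allI impI)
    fix x and \<epsilon> :: real assume "0 < \<epsilon>"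
    then obtain y where y: "\<And>e. e \<in> E \<Longrightarrow> y e \<in> S e"
        "norm x + 1 - \<epsilon> < norm (x + (\<Sum>e\<in>E. c e *\<^sub>R y e))"
      using far_reaching_combination[where I = E and c = c and S = S and x = x and \<epsilon> = \<epsilon>] E(1,3,4) S(2)
      by auto
    let ?u = "\<Sum>e\<in>E. c e *\<^sub>R y e"
    have "?u \<in> C"
      using y(1) S(1) by (intro convex_sum[OF E(1) C(1) E(4)] E(3)) blast+
    have "T ?u - T y0 = (\<Sum>e\<in>E. c e *\<^sub>R (T (y e) - e))"
      unfolding E(5)[symmetric]
      by (simp add: linear_sum[OF bounded_linear.linear[OF T]] linear_scale[OF bounded_linear.linear[OF T]]
          scaleR_diff_right sum_subtractf)
    also have "norm \<dots> \<le> (\<Sum>e\<in>E. c e * (r / 2))"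
    proof (rule sum_norm_le)
      fix e assume e: "e \<in> E"
      show "norm (c e *\<^sub>R (T (y e) - e)) \<le> c e * (r / 2)"
        using mult_left_mono[OF less_imp_le[OF S(3)[OF e y(1)[OF e]]] E(3)[OF e]] E(3)[OF e]
        by (simp add: dist_norm)
    qed
    also have "\<dots> = r / 2"
      using E(4) by (simp only: sum_distrib_right[symmetric] mult_1_left)
    finally have "T ?u \<in> ball (T y0) r"
      using r(1) by (simp add: dist_norm norm_minus_commute)
    then show "\<exists>u\<in>{y \<in> C. T y \<in> V}. norm x + 1 - \<epsilon> < norm (x + u)"
      using r(2) y(2) \<open>?u \<in> C\<close> by blast
  qed
qed

text \<open>
  A slice of the strip by a functional \<open>h\<close> is the preimage of an open subset of the plane under
  \<open>(f, h)\<close>. Because the conclusion is again about all slices, functionals can be added one at a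
  time, and the previous lemma is needed only for maps into the plane.
\<close>
lemma slices_far_reaching_strip:
  assumes C: "convex C" "bounded C" "slices_far_reaching C" and f: "bounded_linear f"
  shows "slices_far_reaching {y \<in> C. \<bar>f y - b\<bar> < (\<delta>::real)}"
  unfolding slices_far_reaching_def
proof (intro allI impI)
  fix h :: "'a \<Rightarrow> real" and \<beta> assume h: "bounded_linear h"
    and "\<exists>y\<in>{y \<in> C. \<bar>f y - b\<bar> < \<delta>}. \<beta> < h y"
  then obtain y where y: "y \<in> C" "\<bar>f y - b\<bar> < \<delta>" "\<beta> < h y" by blast
  let ?V = "{b - \<delta><..<b + \<delta>} \<times> {\<beta><..}"
  have "far_reaching {y \<in> C. (f y, h y) \<in> ?V}"
    using y by (intro far_reaching_preimage[OF C bounded_linear_Pair[OF f h] _ y(1)] open_Times) auto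
  moreover have "{y \<in> C. (f y, h y) \<in> ?V} = {y \<in> {y \<in> C. \<bar>f y - b\<bar> < \<delta>}. \<beta> < h y}"
    by auto
  ultimately show "far_reaching {y \<in> {y \<in> C. \<bar>f y - b\<bar> < \<delta>}. \<beta> < h y}" by simp
qed

lemma slices_far_reaching_weak_neighbourhood:
  assumes ball: "slices_far_reaching (cball 0 1 :: 'a::real_normed_vector set)"
    and "finite F" "\<And>f. f \<in> F \<Longrightarrow> bounded_linear f"
  shows "slices_far_reaching {y :: 'a. norm y \<le> 1 \<and> (\<forall>f\<in>F. \<bar>f y - b f\<bar> < (\<delta>::real))}"
    (is "slices_far_reaching (?C F)")
  using assms(2,3)
proof (induction F rule: finite_induct)
  case empty
  have "?C {} = cball 0 1" by auto
  then show ?case using ball by simp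
next
  case (insert f F)
  have eq: "?C F = cball 0 1 \<inter> (\<Inter>f\<in>F. f -` {b f - \<delta><..<b f + \<delta>})"
    by (auto simp: abs_diff_less_iff)
  have "convex (?C F)"
    unfolding eq using insert.prems
    by (intro convex_Int convex_INT convex_linear_vimage bounded_linear.linear) auto
  moreover have "bounded (?C F)"
    by (rule bounded_subset[OF bounded_cball[of 0 1]]) auto
  ultimately have "slices_far_reaching {y \<in> ?C F. \<bar>f y - b f\<bar> < \<delta>}"
    using insert by (intro slices_far_reaching_strip) auto
  moreover have "{y \<in> ?C F. \<bar>f y - b f\<bar> < \<delta>} = ?C (insert f F)" by auto
  ultimately show ?case by simp
qed

text \<open>
  The Daugavet equation for the rank-one operator \<open>R y = f y *\<^sub>R x\<close> gives \<open>y\<close> in the unit ball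
  with \<open>norm (y + f y *\<^sub>R x)\<close> almost \<open>1 + norm x\<close>. After a change of sign \<open>f y \<ge> 0\<close>, and then
  \<open>f y\<close> must be almost \<open>1\<close>: thus \<open>y\<close> lies in the slice, and replacing \<open>f y *\<^sub>R x\<close> by \<open>x\<close> costs
  little.
\<close>
lemma daugavet_slice_point:
  fixes f :: "'a::banach \<Rightarrow> real" and x :: 'a
  assumes D: "daugavet_property TYPE('a)" and f: "bounded_linear f" and f1: "onorm f = 1"
    and x: "x \<noteq> 0" and \<alpha>: "\<alpha> < 1" and \<epsilon>: "0 < \<epsilon>"
  shows "\<exists>y. norm y \<le> 1 \<and> \<alpha> < f y \<and> norm x + 1 - \<epsilon> < norm (x + y)"
proof -
  interpret f: bounded_linear f by fact
  have f_le: "\<bar>f y\<bar> \<le> norm y" for y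
    using onorm[OF f, of y] f1 by simp
  define R where "R = (\<lambda>y. f y *\<^sub>R x)"
  have R: "bounded_linear R"
    unfolding R_def by (rule bounded_linear_scaleR_const[OF f])
  have "\<exists>y. f y \<noteq> 0"
    using f1 onorm_eq_0[OF f] by auto
  then obtain y0 where y0: "f y0 \<noteq> 0" ..
  have "range R = span {x}"
  proof -
    have "k *\<^sub>R x \<in> range R" for k
      using y0 f.scale[of "k / f y0" y0] unfolding R_def
      by (intro image_eqI[of _ _ "(k / f y0) *\<^sub>R y0"]) auto
    then show ?thesis unfolding span_singleton R_def by auto
  qed
  then have "dim (range R) = 1"
    using x by (simp add: dim_eq_card[of "{x}"])
  then have "onorm (\<lambda>y. y + R y) = 1 + onorm R"
    using D R unfolding daugavet_property_def by blast
  also have "onorm R = norm x"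
    unfolding R_def onorm_scaleR_left[OF f] f1 by simp
  finally have on: "onorm (\<lambda>y. y + R y) = 1 + norm x" .
  \<comment> \<open>The first bound pays for the two losses of size \<open>\<eta>\<close> in the final estimate, the second turns
    \<open>(1 - f y) * norm x < \<eta>\<close> into \<open>\<alpha> < f y\<close>.\<close>
  define \<eta> where "\<eta> = min (\<epsilon> / 2) ((1 - \<alpha>) * norm x)"
  have \<eta>: "0 < \<eta>" "2 * \<eta> \<le> \<epsilon>" "\<eta> \<le> (1 - \<alpha>) * norm x"
    using \<epsilon> \<alpha> x by (auto simp: \<eta>_def)
  have "\<exists>y. norm y \<le> 1 \<and> 1 + norm x - \<eta> < norm (y + R y)"
  proof (rule ccontr)
    assume no: "\<not> ?thesis"
    have "norm (y + R y) \<le> (1 + norm x - \<eta>) * norm y" for y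
    proof (cases "y = 0")
      case True
      then show ?thesis by (simp add: R_def)
    next
      case False
      have "y + R y = norm y *\<^sub>R (sgn y + R (sgn y))"
        using False by (simp add: R_def sgn_div_norm f.scaleR scaleR_add_right)
      then have "norm (y + R y) = norm y * norm (sgn y + R (sgn y))"
        by (metis abs_norm_cancel norm_scaleR)
      also have "\<dots> \<le> norm y * (1 + norm x - \<eta>)"
        using no by (intro mult_left_mono) (auto simp: norm_sgn not_less)
      finally show ?thesis by (simp add: mult.commute)
    qed
    moreover have "0 \<le> 1 + norm x - \<eta>"
    proof -
      have "norm (0 + R 0) \<le> 1 + norm x - \<eta>"
        using no by (metis norm_zero not_less zero_le_one)
      then show ?thesis by (simp add: R_def f.zero)
    qed
    ultimately have "onorm (\<lambda>y. y + R y) \<le> 1 + norm x - \<eta>"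
      by (intro onorm_bound)
    then show False using on \<eta>(1) by simp
  qed
  then obtain y1 where y1: "norm y1 \<le> 1" "1 + norm x - \<eta> < norm (y1 + R y1)" by blast
  define y where "y = (if 0 \<le> f y1 then y1 else - y1)"
  have fy: "0 \<le> f y" and ny: "norm y \<le> 1"
    using y1(1) by (auto simp: y_def f.neg)
  have "norm (y + f y *\<^sub>R x) = norm (y1 + R y1)"
    using norm_minus_cancel[of "y1 + R y1"] by (simp add: y_def R_def f.neg del: norm_minus_cancel)
  then have yR: "1 + norm x - \<eta> < norm (y + f y *\<^sub>R x)"
    using y1(2) by simp
  have "norm (y + f y *\<^sub>R x) \<le> 1 + f y * norm x"
    using norm_triangle_ineq[of y "f y *\<^sub>R x"] ny fy by simp
  then have small: "(1 - f y) * norm x < \<eta>"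
    using yR by (simp add: algebra_simps)
  then have "(1 - f y) * norm x < (1 - \<alpha>) * norm x"
    using \<eta>(3) by simp
  then have "\<alpha> < f y"
    using mult_less_cancel_right_pos[of "norm x" "1 - f y" "1 - \<alpha>"] x by simp
  moreover have "norm x + 1 - \<epsilon> < norm (x + y)"
  proof -
    have "norm (y + f y *\<^sub>R x) = norm ((x + y) - (1 - f y) *\<^sub>R x)"
      by (simp add: algebra_simps)
    also have "\<dots> \<le> norm (x + y) + \<bar>1 - f y\<bar> * norm x"
      using norm_triangle_ineq4[of "x + y" "(1 - f y) *\<^sub>R x"] by simp
    also have "\<bar>1 - f y\<bar> = 1 - f y"
      using f_le[of y] ny by simp
    finally show ?thesis using yR small \<eta>(2) by simp
  qed
  ultimately show ?thesis using ny by blast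
qed

lemma daugavet_slice_far_reaching:
  fixes f :: "'a::banach \<Rightarrow> real"
  assumes D: "daugavet_property TYPE('a)" and f: "bounded_linear f" and z: "f z \<noteq> 0"
    and y0: "norm y0 \<le> 1" "\<alpha> < f y0"
  shows "far_reaching {y. norm y \<le> 1 \<and> \<alpha> < f y}"
proof -
  have pos: "0 < onorm f" using z onorm_pos_lt[OF f] by blast
  have g: "bounded_linear (\<lambda>y. (1 / onorm f) *\<^sub>R f y)"
    by (rule bounded_linear_const_scaleR[OF f])
  have g1: "onorm (\<lambda>y. (1 / onorm f) *\<^sub>R f y) = 1"
    unfolding onorm_scaleR[OF f] using pos by simp
  have "f y0 \<le> onorm f * norm y0"
    using onorm[OF f, of y0] by simp
  also have "\<dots> \<le> onorm f * 1"
    using y0(1) pos by (intro mult_left_mono) auto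
  finally have \<alpha>: "\<alpha> / onorm f < 1"
    using y0(2) pos by (simp add: field_simps)
  have far: "\<exists>y. (norm y \<le> 1 \<and> \<alpha> < f y) \<and> norm x + 1 - \<epsilon> < norm (x + y)"
    if "x \<noteq> 0" "0 < \<epsilon>" for x \<epsilon>
    using daugavet_slice_point[OF D g g1 that(1) \<alpha> that(2)] pos by (simp add: divide_less_cancel)
  show ?thesis
    unfolding far_reaching_def
  proof (intro allI impI)
    fix x :: 'a and \<epsilon> :: real assume \<epsilon>: "0 < \<epsilon>"
    show "\<exists>y\<in>{y. norm y \<le> 1 \<and> \<alpha> < f y}. norm x + 1 - \<epsilon> < norm (x + y)"
    proof (cases "x = 0")
      case False
      then show ?thesis using far[OF False \<epsilon>] by blast
    next
      case True
      \<comment> \<open>For \<open>x = 0\<close> only a point of the slice of norm almost \<open>1\<close> is wanted; a point far from \<open>- z\<close>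
        has this property, for any nonzero \<open>z\<close>.\<close>
      have "z \<noteq> 0" using z linear_0[OF bounded_linear.linear[OF f]] by auto
      then obtain y where y: "norm y \<le> 1 \<and> \<alpha> < f y" "norm z + 1 - \<epsilon> < norm (z + y)"
        using far \<epsilon> by blast
      then have "1 - \<epsilon> < norm y"
        using norm_triangle_ineq[of z y] by simp
      then show ?thesis using y(1) True by auto
    qed
  qed
qed

lemma bounded_linear_norm_bound:
  fixes f :: "'a::real_normed_vector \<Rightarrow> real"
  assumes "linear f" "\<And>x. \<bar>f x\<bar> \<le> norm x"
  shows "bounded_linear f"
  using assms by (intro bounded_linear.intro bounded_linear_axioms.intro exI[of _ 1]) auto

lemma daugavet_slices_far_reaching:
  assumes D: "daugavet_property TYPE('a::banach)" and ne: "(UNIV :: 'a set) \<noteq> {0}"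
  shows "slices_far_reaching (cball 0 1 :: 'a set)"
  unfolding slices_far_reaching_def
proof (intro allI impI)
  fix h :: "'a \<Rightarrow> real" and \<beta> assume h: "bounded_linear h" and "\<exists>y\<in>cball 0 1. \<beta> < h y"
  then obtain y where y: "norm y \<le> 1" "\<beta> < h y" by auto
  show "far_reaching {y \<in> cball 0 1. \<beta> < h y}"
  proof (cases "\<exists>z. h z \<noteq> 0")
    case True
    then obtain z where "h z \<noteq> 0" by blast
    then have "far_reaching {y. norm y \<le> 1 \<and> \<beta> < h y}"
      by (rule daugavet_slice_far_reaching[OF D h _ y])
    then show ?thesis by simp
  next
    case False
    \<comment> \<open>The slice is now the whole ball; it contains a slice by a nonzero functional, which exists by
      the Hahn--Banach theorem.\<close>
    obtain e :: 'a where e: "e \<noteq> 0"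
      using ne by (metis UNIV_eq_I singleton_iff)
    obtain g where g: "linear g" "\<And>x. \<bar>g x\<bar> \<le> norm x" "g e = norm e"
      using norming_functional[of e] by blast
    have "far_reaching {y. norm y \<le> 1 \<and> - 1 < g y}"
      using e g linear_0[OF g(1)]
      by (intro daugavet_slice_far_reaching[OF D bounded_linear_norm_bound, of g e 0]) auto
    then show ?thesis
      by (rule far_reaching_mono) (use False y(2) in auto)
  qed
qed

text \<open>
  The weak form of the Daugavet property for balls of arbitrary radius. Since \<open>\<rho>\<close> may exceed
  \<open>norm y\<close>, the lemma also says that norms can be increased within weak neighbourhoods.
\<close>
theorem daugavet_weak_neighbourhood:
  fixes x y :: "'a::banach" and F :: "('a \<Rightarrow> real) set"
  assumes D: "daugavet_property TYPE('a)" "(UNIV :: 'a set) \<noteq> {0}"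
    and F: "finite F" "\<And>f. f \<in> F \<Longrightarrow> bounded_linear f"
    and y: "norm y \<le> \<rho>" and \<delta>: "0 < \<delta>" and \<epsilon>: "0 < \<epsilon>"
  shows "\<exists>u. norm u \<le> \<rho> \<and> (\<forall>f\<in>F. \<bar>f u - f y\<bar> < \<delta>) \<and> \<rho> + norm x - \<epsilon> \<le> norm (u - x)"
proof (cases "\<rho> = 0")
  case True
  then have "y = 0" using y by simp
  then show ?thesis using True \<delta> \<epsilon> by (intro exI[of _ 0]) simp
next
  case False
  then have \<rho>: "0 < \<rho>" using y norm_ge_zero[of y] by linarith
  let ?C = "{v. norm v \<le> 1 \<and> (\<forall>f\<in>F. \<bar>f v - f (y /\<^sub>R \<rho>)\<bar> < \<delta> / \<rho>)}"
  have "slices_far_reaching ?C"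
    by (rule slices_far_reaching_weak_neighbourhood[OF daugavet_slices_far_reaching[OF D] F])
  moreover have "y /\<^sub>R \<rho> \<in> ?C"
    using y \<rho> \<delta> by (simp add: pos_divide_le_eq divide_inverse_commute[symmetric])
  ultimately have "far_reaching {v \<in> ?C. - 1 < (0::real)}"
    using slices_far_reachingD[of ?C "\<lambda>_. 0" "y /\<^sub>R \<rho>" "- 1"] bounded_linear_zero by simp
  then have "far_reaching ?C"
    by (rule far_reaching_mono) (rule Collect_restrict)
  then have "\<exists>v\<in>?C. norm (- x) + \<rho> - \<epsilon> < norm (- x + \<rho> *\<^sub>R v)"
    by (rule far_reaching_scaled) (use \<rho> \<epsilon> in auto)
  then obtain v where v: "v \<in> ?C" "norm (- x) + \<rho> - \<epsilon> < norm (- x + \<rho> *\<^sub>R v)"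
    by (elim bexE)
  have "\<bar>f (\<rho> *\<^sub>R v) - f y\<bar> < \<delta>" if f: "f \<in> F" for f
  proof -
    have "f (\<rho> *\<^sub>R v) - f y = \<rho> * (f v - f (y /\<^sub>R \<rho>))"
      using \<rho> by (simp add: linear_scale[OF bounded_linear.linear[OF F(2)[OF f]]] right_diff_distrib)
    then have "\<bar>f (\<rho> *\<^sub>R v) - f y\<bar> = \<rho> * \<bar>f v - f (y /\<^sub>R \<rho>)\<bar>"
      using \<rho> by (simp add: abs_mult)
    also have "\<dots> < \<rho> * (\<delta> / \<rho>)"
      using v(1) f \<rho> by (intro mult_strict_left_mono) auto
    finally show ?thesis using \<rho> by simp
  qed
  moreover have "norm (\<rho> *\<^sub>R v) \<le> \<rho>" using v(1) \<rho> by simp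
  moreover have "\<rho> + norm x - \<epsilon> \<le> norm (\<rho> *\<^sub>R v - x)"
    using v(2) by (simp add: algebra_simps)
  ultimately show ?thesis by blast
qed

section \<open>Distances within weak neighbourhoods in direct sums\<close>

text \<open>
  Every weak neighbourhood of \<open>y\<close> contains points of the \<open>\<nu>\<close>-ball of radius \<open>l\<close> whose distance to
  \<open>x\<close> is at least \<open>k\<close>, up to an arbitrarily small error. Keeping \<open>l\<close> as a parameter makes it
  possible to combine the statements for two summands, where the radius is shared between the
  components.
\<close>
definition escapes :: "('a::real_vector \<Rightarrow> real) \<Rightarrow> real \<Rightarrow> 'a \<Rightarrow> 'a \<Rightarrow> real \<Rightarrow> bool" where
  "escapes \<nu> l y x k \<longleftrightarrow> (\<forall>F \<delta> \<epsilon>. finite F \<longrightarrow> (\<forall>f\<in>F. dual_functional \<nu> f) \<longrightarrow> 0 < \<delta> \<longrightarrow> 0 < \<epsilon>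
     \<longrightarrow> (\<exists>u. \<nu> u \<le> l \<and> (\<forall>f\<in>F. \<bar>f u - f y\<bar> < \<delta>) \<and> k - \<epsilon> \<le> \<nu> (u - x)))"

lemma escapesD:
  assumes "escapes \<nu> l y x k" "finite F" "\<And>f. f \<in> F \<Longrightarrow> dual_functional \<nu> f" "0 < \<delta>" "0 < \<epsilon>"
  obtains u where "\<nu> u \<le> l" "\<And>f. f \<in> F \<Longrightarrow> \<bar>f u - f y\<bar> < \<delta>" "k - \<epsilon> \<le> \<nu> (u - x)"
  using assms(1)[unfolded escapes_def, rule_format, OF assms(2-5)] that by metis

lemma escapes_mono:
  assumes "escapes \<nu> l y x k" "l \<le> l'" "k' \<le> k"
  shows "escapes \<nu> l' y x k'"
  unfolding escapes_def
proof (intro allI impI)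
  fix F and \<delta> \<epsilon> :: real
  assume "finite F" "\<forall>f\<in>F. dual_functional \<nu> f" "0 < \<delta>" "0 < \<epsilon>"
  then obtain u where "\<nu> u \<le> l" "\<And>f. f \<in> F \<Longrightarrow> \<bar>f u - f y\<bar> < \<delta>" "k - \<epsilon> \<le> \<nu> (u - x)"
    using escapesD[OF assms(1), of F \<delta> \<epsilon>] by blast
  then show "\<exists>u. \<nu> u \<le> l' \<and> (\<forall>f\<in>F. \<bar>f u - f y\<bar> < \<delta>) \<and> k' - \<epsilon> \<le> \<nu> (u - x)"
    using assms(2,3) by (intro exI[of _ u]) auto
qed

lemma daugavet_escapes:
  fixes x y :: "'a::banach"
  assumes D: "daugavet_property TYPE('a)" "(UNIV :: 'a set) \<noteq> {0}" and y: "norm y \<le> \<rho>"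
  shows "escapes norm \<rho> y x (\<rho> + norm x)"
  unfolding escapes_def dual_functional_norm
  using daugavet_weak_neighbourhood[OF D _ _ y] by blast

lemma norm_sum_Pair [simp]: "norm_sum N \<mu> \<nu> (x, y) = N (\<mu> x, \<nu> y)"
  by (simp add: norm_sum_def)

lemma normalised_axes:
  assumes N: "is_norm N" "normalised N"
  shows "N (a, 0) = \<bar>a\<bar>" "N (0, b) = \<bar>b\<bar>"
  using is_norm_scale[OF N(1), of a "(1, 0)"] is_norm_scale[OF N(1), of b "(0, 1)"] N(2)
  by (simp_all add: normalised_def)

lemma normalised_le_sum:
  assumes N: "is_norm N" "normalised N"
  shows "N (a, b) \<le> \<bar>a\<bar> + \<bar>b\<bar>"
  using is_norm_triangle[OF N(1), of "(a, 0)" "(0, b)"] by (simp add: normalised_axes[OF N])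

lemma is_norm_zero: "is_norm \<nu> \<Longrightarrow> \<nu> 0 = 0"
  by (simp add: is_norm_def)

context
  fixes N :: "real \<times> real \<Rightarrow> real"
    and \<mu> :: "'a::real_vector \<Rightarrow> real" and \<nu> :: "'b::real_vector \<Rightarrow> real"
  assumes N: "is_norm N" "absolute N" "normalised N" and \<mu>: "is_norm \<mu>" and \<nu>: "is_norm \<nu>"
begin

lemma component_le_norm_sum: "\<mu> x \<le> norm_sum N \<mu> \<nu> (x, y)" "\<nu> y \<le> norm_sum N \<mu> \<nu> (x, y)"
  using absolute_norm_mono[OF N(1,2), of "\<mu> x" "\<mu> x" 0 "\<nu> y"]
    absolute_norm_mono[OF N(1,2), of 0 "\<mu> x" "\<nu> y" "\<nu> y"]
    is_norm_nonneg[OF \<mu>] is_norm_nonneg[OF \<nu>]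
  by (simp_all add: normalised_axes[OF N(1,3)])

lemma dual_functional_fst:
  assumes "dual_functional \<mu> f"
  shows "dual_functional (norm_sum N \<mu> \<nu>) (\<lambda>z. f (fst z))"
proof -
  obtain K where K: "\<And>x. \<bar>f x\<bar> \<le> K * \<mu> x" and f: "linear f"
    using assms unfolding dual_functional_def by blast
  have "\<bar>f (fst z)\<bar> \<le> \<bar>K\<bar> * norm_sum N \<mu> \<nu> z" for z
  proof -
    have "K * \<mu> (fst z) \<le> \<bar>K\<bar> * norm_sum N \<mu> \<nu> z"
      using component_le_norm_sum(1)[of "fst z" "snd z"] is_norm_nonneg[OF \<mu>, of "fst z"]
      by (intro mult_mono) auto
    then show ?thesis using K[of "fst z"] by linarith
  qed
  moreover have "linear (\<lambda>z. f (fst z))"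
    using linear_compose[OF linear_fst f] by (simp add: o_def)
  ultimately show ?thesis unfolding dual_functional_def by blast
qed

lemma dual_functional_snd:
  assumes "dual_functional \<nu> f"
  shows "dual_functional (norm_sum N \<mu> \<nu>) (\<lambda>z. f (snd z))"
proof -
  obtain K where K: "\<And>x. \<bar>f x\<bar> \<le> K * \<nu> x" and f: "linear f"
    using assms unfolding dual_functional_def by blast
  have "\<bar>f (snd z)\<bar> \<le> \<bar>K\<bar> * norm_sum N \<mu> \<nu> z" for z
  proof -
    have "K * \<nu> (snd z) \<le> \<bar>K\<bar> * norm_sum N \<mu> \<nu> z"
      using component_le_norm_sum(2)[of "snd z" "fst z"] is_norm_nonneg[OF \<nu>, of "snd z"]
      by (intro mult_mono) auto
    then show ?thesis using K[of "snd z"] by linarith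
  qed
  moreover have "linear (\<lambda>z. f (snd z))"
    using linear_compose[OF linear_snd f] by (simp add: o_def)
  ultimately show ?thesis unfolding dual_functional_def by blast
qed

lemma dual_functional_restrict:
  assumes "dual_functional (norm_sum N \<mu> \<nu>) f"
  shows "dual_functional \<mu> (\<lambda>x. f (x, 0))" "dual_functional \<nu> (\<lambda>y. f (0, y))"
    "f (x, y) = f (x, 0) + f (0, y)"
proof -
  obtain K where K: "\<And>z. \<bar>f z\<bar> \<le> K * norm_sum N \<mu> \<nu> z" and f: "linear f"
    using assms unfolding dual_functional_def by blast
  have "linear (\<lambda>x. f (x, 0))" "linear (\<lambda>y. f (0, y))"
    using linear_add[OF f, of "(_, 0)" "(_, 0)"] linear_add[OF f, of "(0, _)" "(0, _)"]
      linear_scale[OF f, of _ "(_, 0)"] linear_scale[OF f, of _ "(0, _)"]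
    by (auto intro!: linearI)
  moreover have "\<bar>f (x, 0)\<bar> \<le> K * \<mu> x" "\<bar>f (0, y)\<bar> \<le> K * \<nu> y" for x y
    using K[of "(x, 0)"] K[of "(0, y)"] is_norm_nonneg[OF \<mu>, of x] is_norm_nonneg[OF \<nu>, of y]
    by (simp_all add: is_norm_zero[OF \<mu>] is_norm_zero[OF \<nu>] normalised_axes[OF N(1,3)])
  ultimately show "dual_functional \<mu> (\<lambda>x. f (x, 0))" "dual_functional \<nu> (\<lambda>y. f (0, y))"
    unfolding dual_functional_def by blast+
  show "f (x, y) = f (x, 0) + f (0, y)"
    using linear_add[OF f, of "(x, 0)" "(0, y)"] by simp
qed

text \<open>
  A functional on the sum is the sum of its restrictions to the two summands, so the two
  components can be moved independently; monotonicity of the absolute norm then controls the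
  radius and the distance. Since \<open>k1 - \<epsilon> / 2\<close> may be negative, the error is added to the larger
  side, where it costs \<open>N (\<epsilon> / 2, \<epsilon> / 2) \<le> \<epsilon>\<close>.
\<close>
lemma escapes_norm_sum:
  assumes 1: "escapes \<mu> a y1 x1 k1" and 2: "escapes \<nu> b y2 x2 k2" and k: "0 \<le> k1" "0 \<le> k2"
  shows "escapes (norm_sum N \<mu> \<nu>) (N (a, b)) (y1, y2) (x1, x2) (N (k1, k2))"
  unfolding escapes_def
proof (intro allI impI)
  fix F and \<delta> \<epsilon> :: real
  assume F: "finite F" "\<forall>f\<in>F. dual_functional (norm_sum N \<mu> \<nu>) f" and \<delta>: "0 < \<delta>" and \<epsilon>: "0 < \<epsilon>"
  have F1: "dual_functional \<mu> f" if "f \<in> (\<lambda>f x. f (x, 0)) ` F" for f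
    using that F(2) dual_functional_restrict(1) by auto
  have F2: "dual_functional \<nu> f" if "f \<in> (\<lambda>f y. f (0, y)) ` F" for f
    using that F(2) dual_functional_restrict(2) by auto
  obtain u1 where u1: "\<mu> u1 \<le> a"
      "\<And>f. f \<in> (\<lambda>f x. f (x, 0)) ` F \<Longrightarrow> \<bar>f u1 - f y1\<bar> < \<delta> / 2" "k1 - \<epsilon> / 2 \<le> \<mu> (u1 - x1)"
    using escapesD[OF 1 finite_imageI[OF F(1)] F1 half_gt_zero[OF \<delta>] half_gt_zero[OF \<epsilon>]] by blast
  obtain u2 where u2: "\<nu> u2 \<le> b"
      "\<And>f. f \<in> (\<lambda>f y. f (0, y)) ` F \<Longrightarrow> \<bar>f u2 - f y2\<bar> < \<delta> / 2" "k2 - \<epsilon> / 2 \<le> \<nu> (u2 - x2)"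
    using escapesD[OF 2 finite_imageI[OF F(1)] F2 half_gt_zero[OF \<delta>] half_gt_zero[OF \<epsilon>]] by blast
  have "norm_sum N \<mu> \<nu> (u1, u2) \<le> N (a, b)"
    using u1(1) u2(1) is_norm_nonneg[OF \<mu>, of u1] is_norm_nonneg[OF \<nu>, of u2]
    by (simp, intro absolute_norm_mono[OF N(1,2)]) auto
  moreover have "\<bar>f (u1, u2) - f (y1, y2)\<bar> < \<delta>" if f: "f \<in> F" for f
  proof -
    have "\<bar>f (u1, 0) - f (y1, 0)\<bar> < \<delta> / 2" "\<bar>f (0, u2) - f (0, y2)\<bar> < \<delta> / 2"
      using u1(2) u2(2) f by blast+
    moreover have "f (u1, u2) = f (u1, 0) + f (0, u2)" "f (y1, y2) = f (y1, 0) + f (0, y2)"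
      using F(2) f by (blast intro: dual_functional_restrict(3))+
    ultimately show ?thesis by linarith
  qed
  moreover have "N (k1, k2) - \<epsilon> \<le> norm_sum N \<mu> \<nu> ((u1, u2) - (x1, x2))"
  proof -
    have "N (k1, k2) \<le> N (\<mu> (u1 - x1) + \<epsilon> / 2, \<nu> (u2 - x2) + \<epsilon> / 2)"
      using u1(3) u2(3) k by (intro absolute_norm_mono[OF N(1,2)]) auto
    also have "\<dots> \<le> N (\<mu> (u1 - x1), \<nu> (u2 - x2)) + N (\<epsilon> / 2, \<epsilon> / 2)"
      using is_norm_triangle[OF N(1), of "(\<mu> (u1 - x1), \<nu> (u2 - x2))" "(\<epsilon> / 2, \<epsilon> / 2)"] by simp
    also have "N (\<epsilon> / 2, \<epsilon> / 2) \<le> \<epsilon>"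
      using normalised_le_sum[OF N(1,3), of "\<epsilon> / 2" "\<epsilon> / 2"] \<epsilon> by simp
    finally show ?thesis by simp
  qed
  ultimately show "\<exists>u. norm_sum N \<mu> \<nu> u \<le> N (a, b) \<and> (\<forall>f\<in>F. \<bar>f u - f (y1, y2)\<bar> < \<delta>)
      \<and> N (k1, k2) - \<epsilon> \<le> norm_sum N \<mu> \<nu> (u - (x1, x2))"
    by blast
qed

end

text \<open>
  With this norm the \<open>\<ell>\<^sub>1\<close>-sum becomes a special case of the sums with an absolute norm.
\<close>
definition l1_norm :: "real \<times> real \<Rightarrow> real" where
  "l1_norm = (\<lambda>(a, b). \<bar>a\<bar> + \<bar>b\<bar>)"

lemma l1_norm_absolute_normalised: "is_norm l1_norm" "absolute l1_norm" "normalised l1_norm"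
  by (auto simp: l1_norm_def is_norm_def absolute_def normalised_def abs_mult distrib_left
      zero_prod_def)

lemma l1_norm_nonneg_eq: "0 \<le> a \<Longrightarrow> 0 \<le> b \<Longrightarrow> l1_norm (a, b) = a + b"
  by (simp add: l1_norm_def)

lemma norm_sum1_eq_norm_sum:
  assumes "is_norm \<mu>" "is_norm \<nu>"
  shows "norm_sum1 \<mu> \<nu> = norm_sum l1_norm \<mu> \<nu>"
  using assms by (auto simp: fun_eq_iff norm_sum1_def l1_norm_def is_norm_nonneg)

section \<open>Weakly open sets and the index of thickness\<close>

lemma weakly_open_neighbourhood:
  assumes "openin (weak_topology \<nu>) U" "w \<in> U"
  shows "\<exists>F \<delta>. finite F \<and> (\<forall>f\<in>F. dual_functional \<nu> f) \<and> 0 < \<delta>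
    \<and> (\<forall>u. (\<forall>f\<in>F. \<bar>f u - f w\<bar> < \<delta>) \<longrightarrow> u \<in> U)"
proof -
  have "generate_topology_on {f -` U | f U. dual_functional \<nu> f \<and> open U} U"
    using assms(1) unfolding weak_topology_def openin_topology_generated_by_iff .
  then show ?thesis
    using assms(2)
  proof (induction rule: generate_topology_on.induct)
    case Empty
    then show ?case by simp
  next
    case (Int A B)
    obtain F \<delta> where F: "finite F" "\<forall>f\<in>F. dual_functional \<nu> f" "0 < \<delta>"
        "\<forall>u. (\<forall>f\<in>F. \<bar>f u - f w\<bar> < \<delta>) \<longrightarrow> u \<in> A"
      using Int.IH(1) Int.prems by (elim IntE) blast
    obtain G \<gamma> where G: "finite G" "\<forall>f\<in>G. dual_functional \<nu> f" "0 < \<gamma>"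
        "\<forall>u. (\<forall>f\<in>G. \<bar>f u - f w\<bar> < \<gamma>) \<longrightarrow> u \<in> B"
      using Int by blast
    show ?case
      using F(1,2,3) G(1,2,3) F(4)[rule_format] G(4)[rule_format]
      by (intro exI[of _ "F \<union> G"] exI[of _ "min \<delta> \<gamma>"]) (simp add: ball_Un)
  next
    case (UN K)
    then obtain k where "k \<in> K" "w \<in> k" by blast
    note UN.IH[OF this]
    then obtain F \<delta> where F: "finite F" "\<forall>f\<in>F. dual_functional \<nu> f" "0 < \<delta>"
        "\<forall>u. (\<forall>f\<in>F. \<bar>f u - f w\<bar> < \<delta>) \<longrightarrow> u \<in> k"
      by (elim exE conjE)
    show ?case
      using F(1-3) F(4)[rule_format] \<open>k \<in> K\<close>
      by (intro exI[of _ F] exI[of _ \<delta>] conjI allI impI UnionI[of k]) auto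
  next
    case (Basis S)
    then obtain f U where f: "dual_functional \<nu> f" and "open U" "S = f -` U" "f w \<in> U" by blast
    then obtain \<delta> where "0 < \<delta>" "\<And>r. dist r (f w) < \<delta> \<Longrightarrow> r \<in> U"
      unfolding open_dist by blast
    then show ?case
      using f \<open>S = f -` U\<close> by (intro exI[of _ "{f}"] exI[of _ \<delta>]) (simp add: dist_real_def)
  qed
qed

lemma weakly_open_halfspace:
  assumes "dual_functional \<nu> f"
  shows "openin (weak_topology \<nu>) {z. \<alpha> < f z}"
proof -
  have "{z. \<alpha> < f z} = f -` {\<alpha><..}" by auto
  then show ?thesis
    unfolding weak_topology_def using assms open_greaterThan
    by (intro topology_generated_by_Basis) blast
qed

text \<open>
  If every point of the unit ball escapes from every unit vector up to distance \<open>k\<close>, then no ball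
  of radius less than \<open>k\<close> around a unit vector contains a nonempty relatively weakly open set.
\<close>
lemma thickness_eqI:
  assumes k: "0 < k"
    and lower: "\<And>x y. \<nu> x = 1 \<Longrightarrow> \<nu> y \<le> 1 \<Longrightarrow> escapes \<nu> 1 y x k"
    and upper: "\<And>\<epsilon>. 0 < \<epsilon> \<Longrightarrow> \<exists>x U. \<nu> x = 1 \<and> openin (weak_topology \<nu>) U \<and> unit_ball \<nu> \<inter> U \<noteq> {}
      \<and> (\<forall>y \<in> unit_ball \<nu> \<inter> U. \<nu> (y - x) \<le> k + \<epsilon>)"
  shows "thickness \<nu> = k"
proof -
  let ?R = "{r. r > 0 \<and> (\<exists>x W. \<nu> x = 1 \<and> W \<noteq> {} \<and> rel_weakly_open \<nu> W
     \<and> W \<subseteq> {y. \<nu> (y - x) \<le> r})}"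
  have mem: "k + \<epsilon> \<in> ?R" if \<epsilon>: "0 < \<epsilon>" for \<epsilon>
  proof -
    obtain x U where "\<nu> x = 1" "openin (weak_topology \<nu>) U" "unit_ball \<nu> \<inter> U \<noteq> {}"
        "\<forall>y \<in> unit_ball \<nu> \<inter> U. \<nu> (y - x) \<le> k + \<epsilon>"
      using upper[OF \<epsilon>] by blast
    moreover from this have "rel_weakly_open \<nu> (unit_ball \<nu> \<inter> U)"
      unfolding rel_weakly_open_def by (simp add: openin_subtopology_Int2)
    moreover have "0 < k + \<epsilon>" using k \<epsilon> by simp
    ultimately show ?thesis by blast
  qed
  have ge: "k \<le> r" if r: "r \<in> ?R" for r
  proof (rule field_le_epsilon)
    fix \<epsilon> :: real assume \<epsilon>: "0 < \<epsilon>"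
    obtain x W where x: "\<nu> x = 1" and W: "W \<noteq> {}" "rel_weakly_open \<nu> W" "W \<subseteq> {y. \<nu> (y - x) \<le> r}"
      using r by blast
    obtain U where U: "openin (weak_topology \<nu>) U" "W = U \<inter> unit_ball \<nu>"
      using W(2) unfolding rel_weakly_open_def openin_subtopology by blast
    obtain w where w: "w \<in> U" "\<nu> w \<le> 1"
      using W(1) U(2) by (auto simp: unit_ball_def)
    obtain F \<delta> where F: "finite F" "\<forall>f\<in>F. dual_functional \<nu> f" "0 < \<delta>"
        "\<forall>u. (\<forall>f\<in>F. \<bar>f u - f w\<bar> < \<delta>) \<longrightarrow> u \<in> U"
      using weakly_open_neighbourhood[OF U(1) w(1)] by blast
    obtain u where u: "\<nu> u \<le> 1" "\<And>f. f \<in> F \<Longrightarrow> \<bar>f u - f w\<bar> < \<delta>" "k - \<epsilon> \<le> \<nu> (u - x)"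
      using escapesD[OF lower[OF x w(2)] F(1) _ F(3) \<epsilon>] F(2) by blast
    then have "u \<in> W"
      using F(4) U(2) by (simp add: unit_ball_def)
    then show "k \<le> r + \<epsilon>"
      using W(3) u(3) by force
  qed
  have "Inf ?R = k"
  proof (rule antisym)
    show "k \<le> Inf ?R"
    proof (rule cInf_greatest)
      show "?R \<noteq> {}" using mem[OF zero_less_one] by (metis empty_iff)
    qed (rule ge)
    have "bdd_below ?R" using ge by (rule bdd_belowI)
    then have "Inf ?R \<le> k + \<epsilon>" if "0 < \<epsilon>" for \<epsilon>
      using mem[OF that] by (rule cInf_lower[rotated])
    then show "Inf ?R \<le> k" by (rule field_le_epsilon)
  qed
  then show ?thesis unfolding thickness_def .
qed

section \<open>Sums of two spaces with the Daugavet property\<close>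

text \<open>
  A nonzero vector of the quadrant is scaled up, which decreases neither coordinate.
\<close>
lemma normalised_norm_sphere_above:
  assumes N: "is_norm N" "normalised N" and ab: "0 \<le> a" "0 \<le> b" "N (a, b) \<le> l"
  obtains a' b' where "a \<le> a'" "b \<le> b'" "N (a', b') = l"
proof (cases "(a, b) = 0")
  case True
  then have "a \<le> 0" "b \<le> l" "N (0, l) = l"
    using ab normalised_axes[OF N] is_norm_zero[OF N(1)] by (auto simp: zero_prod_def)
  then show ?thesis by (rule that)
next
  case False
  define k where "k = l / N (a, b)"
  have pos: "0 < N (a, b)"
    using False is_norm_nonneg[OF N(1), of "(a, b)"] N(1) by (metis is_norm_def order_le_less)
  then have k: "1 \<le> k" using ab(3) by (simp add: k_def)
  have "N (k * a, k * b) = l"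
    using is_norm_scale[OF N(1), of k "(a, b)"] k pos by (simp add: k_def)
  moreover have "a \<le> k * a" "b \<le> k * b"
    using mult_right_mono[OF k ab(1)] mult_right_mono[OF k ab(2)] by simp_all
  ultimately show ?thesis using that by blast
qed

text \<open>
  The radii of the two components of \<open>y\<close> are first raised to a point \<open>(a, b)\<close> with \<open>N (a, b) = l\<close>.
  In each summand the distance to the component of \<open>x\<close> can then be made almost the radius plus the
  norm of that component, so everything is reduced to an inequality for \<open>N\<close> on the quadrant.
\<close>
lemma daugavet_sum_escapes:
  fixes x y :: "'d::banach \<times> 'd"
  assumes D: "daugavet_property TYPE('d)" "(UNIV :: 'd set) \<noteq> {0}"
    and N: "is_norm N" "absolute N" "normalised N"
    and y: "norm_sum N norm norm y \<le> l"
    and k: "\<And>a b. 0 \<le> a \<Longrightarrow> 0 \<le> b \<Longrightarrow> N (a, b) = l \<Longrightarrow> k \<le> N (a + norm (fst x), b + norm (snd x))"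
  shows "escapes (norm_sum N norm norm) l y x k"
proof -
  have "N (norm (fst y), norm (snd y)) \<le> l" using y by (cases y) simp
  then obtain a b where ab: "norm (fst y) \<le> a" "norm (snd y) \<le> b" "N (a, b) = l"
    using normalised_norm_sphere_above[OF N(1,3) norm_ge_zero norm_ge_zero] by metis
  have nn: "0 \<le> a" "0 \<le> b" using ab norm_ge_zero order_trans by blast+
  have "escapes (norm_sum N norm norm) (N (a, b)) (fst y, snd y) (fst x, snd x)
      (N (a + norm (fst x), b + norm (snd x)))"
    using nn by (intro escapes_norm_sum[OF N is_norm_norm is_norm_norm] daugavet_escapes[OF D] ab) simp_all
  from escapes_mono[OF this _ k[OF nn ab(3)], of l] show ?thesis
    using ab(3) by simp
qed

lemma absolute_norm_perturb:
  assumes N: "is_norm N" "absolute N" "normalised N"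
    and "0 \<le> p" "p \<le> a + \<alpha>" "0 \<le> q" "q \<le> b + \<beta>" "0 \<le> \<alpha>" "0 \<le> \<beta>"
  shows "N (p, q) \<le> N (a, b) + \<alpha> + \<beta>"
proof -
  have "N (p, q) \<le> N (a + \<alpha>, b + \<beta>)"
    using assms by (intro absolute_norm_mono[OF N(1,2)]) auto
  also have "\<dots> \<le> N (a, b) + N (\<alpha>, \<beta>)"
    using is_norm_triangle[OF N(1), of "(a, b)" "(\<alpha>, \<beta>)"] by simp
  also have "N (\<alpha>, \<beta>) \<le> \<alpha> + \<beta>"
    using normalised_le_sum[OF N(1,3), of \<alpha> \<beta>] assms by simp
  finally show ?thesis by simp
qed

context
  fixes s t :: real
  assumes st: "0 < s" "s < t" "t < 1"
begin

lemma N_st_nonneg_eq: "0 \<le> a \<Longrightarrow> 0 \<le> b \<Longrightarrow> N_st s t (a, b) = max (s * a + b) (a + t * b)"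
  by (simp add: N_st_def)

lemma st_less_1: "s * t < 1"
  using mult_strict_mono[of s 1 t 1] st by simp

text \<open>
  On the quadrant \<open>N_st s t\<close> is the larger of the functionals \<open>s * a + b\<close> and \<open>a + t * b\<close>. The
  next two lemmas bound each of them below by a multiple of the other.
\<close>
lemma second_face_ge:
  assumes "0 \<le> a"
  shows "t * (s * a + b) \<le> a + t * b"
  using mult_right_mono[OF less_imp_le[OF st_less_1] assms] by (simp add: algebra_simps)

lemma first_face_ge:
  assumes "0 \<le> b"
  shows "s * (a + t * b) \<le> s * a + b"
  using mult_right_mono[OF less_imp_le[OF st_less_1] assms] by (simp add: algebra_simps)

text \<open>
  If the same functional is \<open>1\<close> on both points, it is \<open>2\<close> on the sum. Otherwise \<open>a + t * b\<close> is \<open>1\<close>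
  at one point and at least \<open>t\<close> at the other.
\<close>
lemma N_st_sphere_add:
  assumes nn: "0 \<le> a" "0 \<le> b" "0 \<le> a'" "0 \<le> b'"
    and "N_st s t (a, b) = 1" "N_st s t (a', b') = 1"
  shows "1 + t \<le> N_st s t (a + a', b + b')"
proof -
  let ?M = "N_st s t (a + a', b + b')"
  have M: "(s * a + b) + (s * a' + b') \<le> ?M" "(a + t * b) + (a' + t * b') \<le> ?M"
    using nn by (simp_all add: N_st_nonneg_eq algebra_simps)
  have "s * a + b = 1 \<or> a + t * b = 1" "s * a' + b' = 1 \<or> a' + t * b' = 1"
    using assms by (auto simp: N_st_nonneg_eq max_def split: if_splits)
  then show ?thesis
    using M second_face_ge[OF nn(1), of b] second_face_ge[OF nn(3), of b'] st by (elim disjE) simp_all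
qed

text \<open>
  If the same functional norms both vectors, the norms add up, and \<open>1 - s * t \<le> 2 - s - t\<close>.
  Otherwise the norm of the sum is bounded below by the convex combination of the two functionals with
  weights \<open>(1 - t) / (2 - s - t)\<close> and \<open>(1 - s) / (2 - s - t)\<close>. These weights are chosen so that
  the bounds for the two vectors come out with the same constant,
  because \<open>(1 - t) + (1 - s) * t = (1 - s) + (1 - t) * s = 1 - s * t\<close>.
\<close>
lemma N_st_add_ge:
  assumes nn: "0 \<le> a" "0 \<le> b" "0 \<le> a'" "0 \<le> b'"
  shows "(1 - s * t) / (2 - s - t) * (N_st s t (a, b) + N_st s t (a', b')) \<le> N_st s t (a + a', b + b')"
proof -
  let ?M = "N_st s t (a + a', b + b')"
  have d: "0 < 2 - s - t" using st by simp
  have M: "(s * a + b) + (s * a' + b') \<le> ?M" "(a + t * b) + (a' + t * b') \<le> ?M"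
    using nn by (simp_all add: N_st_nonneg_eq algebra_simps)
  have M0: "0 \<le> ?M" using M(1) nn st by (smt (verit) mult_nonneg_nonneg)
  have le: "1 - s * t \<le> 2 - s - t"
    using mult_nonneg_nonneg[of "1 - s" "1 - t"] st by (simp add: algebra_simps)
  have same: "(1 - s * t) * m \<le> (2 - s - t) * ?M" if "m \<le> ?M" for m
  proof -
    have "(1 - s * t) * m \<le> (1 - s * t) * ?M"
      using that st_less_1 by (intro mult_left_mono) auto
    also have "\<dots> \<le> (2 - s - t) * ?M" using le M0 by (rule mult_right_mono)
    finally show ?thesis .
  qed
  have mixed: "(1 - s * t) * ((s * p + q) + (p' + t * q')) \<le> (2 - s - t) * ?M"
    if p: "0 \<le> p" and q': "0 \<le> q'" and pq: "(s * p + q) + (s * p' + q') \<le> ?M"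
      "(p + t * q) + (p' + t * q') \<le> ?M" for p q p' q'
  proof -
    have "(1 - t) * ((s * p + q) + s * (p' + t * q')) \<le> (1 - t) * ?M"
      using st first_face_ge[OF q', of p'] pq by (intro mult_left_mono) auto
    moreover have "(1 - s) * (t * (s * p + q) + (p' + t * q')) \<le> (1 - s) * ?M"
      using st second_face_ge[OF p, of q] pq by (intro mult_left_mono) auto
    ultimately show ?thesis by (simp add: algebra_simps)
  qed
  have "(1 - s * t) * (N_st s t (a, b) + N_st s t (a', b')) \<le> (2 - s - t) * ?M"
    using same[OF M(1)] same[OF M(2)] mixed[of a b' b a'] mixed[OF nn(1,4) M] mixed[of a' b b' a] nn M
    unfolding N_st_nonneg_eq[OF nn(1,2)] N_st_nonneg_eq[OF nn(3,4)]
    by (auto simp: max_def add.commute)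
  then show ?thesis
    using d by (simp add: pos_divide_le_eq mult.commute)
qed

text \<open>
  The extremal pair of profiles is \<open>(1, 0)\<close> for the centre and \<open>(0, 1)\<close> for the weakly open set,
  with \<open>N_st s t (1, 1) = 1 + t\<close>. In the unit ball, \<open>s * norm p + norm q \<le> 1\<close>, so a functional
  that forces \<open>norm q\<close> to be almost \<open>1\<close> also forces \<open>norm p\<close> to be almost \<open>0\<close>.
\<close>
theorem thickness_daugavet_N_st:
  assumes D: "daugavet_property TYPE('d::banach)" "(UNIV :: 'd set) \<noteq> {0}"
  shows "thickness (norm_sum (N_st s t) norm norm :: 'd \<times> 'd \<Rightarrow> real) = 1 + t"
proof (rule thickness_eqI)
  let ?N = "N_st s t" and ?X = "norm_sum (N_st s t) norm norm :: 'd \<times> 'd \<Rightarrow> real"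
  note N = N_st_absolute_normalised_norm[OF st]
  show "0 < 1 + t" using st by simp
  show "escapes ?X 1 y x (1 + t)" if x: "?X x = 1" and y: "?X y \<le> 1" for x y
  proof (rule daugavet_sum_escapes[OF D N y])
    fix a b :: real assume "0 \<le> a" "0 \<le> b" "?N (a, b) = 1"
    moreover have "?N (norm (fst x), norm (snd x)) = 1" using x by (cases x) simp
    ultimately show "1 + t \<le> ?N (a + norm (fst x), b + norm (snd x))"
      by (intro N_st_sphere_add) simp_all
  qed
  obtain v :: 'd where "v \<noteq> 0" using D(2) by (metis UNIV_eq_I singleton_iff)
  then obtain e :: 'd where e: "norm e = 1" by (metis norm_sgn)
  obtain f where f: "linear f" "\<And>v. \<bar>f v\<bar> \<le> norm v" "f e = 1"
    using norming_functional[of e] e by auto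
  have df: "dual_functional norm f"
    unfolding dual_functional_norm by (rule bounded_linear_norm_bound[OF f(1,2)])
  fix \<epsilon> :: real assume \<epsilon>: "0 < \<epsilon>"
  let ?U = "{z. 1 - s * \<epsilon> < f (snd z)}"
  have "?X (e, 0) = 1"
    using e by (simp add: normalised_axes[OF N(1,3)])
  moreover have "openin (weak_topology ?X) ?U"
    by (intro weakly_open_halfspace dual_functional_snd[OF N is_norm_norm is_norm_norm df])
  moreover have "(0, e) \<in> unit_ball ?X \<inter> ?U"
    using e f(3) st \<epsilon> by (simp add: unit_ball_def normalised_axes[OF N(1,3)])
  moreover have "?X (y - (e, 0)) \<le> 1 + t + \<epsilon>" if "y \<in> unit_ball ?X \<inter> ?U" for y
  proof -
    obtain p q where y: "y = (p, q)" by (cases y)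
    have "1 - s * \<epsilon> < f q" using that y by simp
    then have q: "1 - s * \<epsilon> < norm q" using f(2)[of q] by linarith
    have "?N (norm p, norm q) \<le> 1" using that y by (simp add: unit_ball_def)
    then have ball: "s * norm p + norm q \<le> 1" by (simp add: N_st_nonneg_eq)
    then have "s * norm p < s * \<epsilon>" using q by simp
    then have "norm p < \<epsilon>" using st by simp
    then have "norm (p - e) \<le> 1 + \<epsilon>" using norm_triangle_ineq4[of p e] e by simp
    moreover have "norm q \<le> 1" using ball st by (smt (verit) mult_nonneg_nonneg norm_ge_zero)
    ultimately have "?N (norm (p - e), norm q) \<le> ?N (1, 1) + \<epsilon> + 0"
      using \<epsilon> by (intro absolute_norm_perturb[OF N]) simp_all
    then show ?thesis using y st by (simp add: N_st_nonneg_eq)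
  qed
  ultimately show "\<exists>x U. ?X x = 1 \<and> openin (weak_topology ?X) U \<and> unit_ball ?X \<inter> U \<noteq> {}
      \<and> (\<forall>y \<in> unit_ball ?X \<inter> U. ?X (y - x) \<le> 1 + t + \<epsilon>)"
    by (intro exI[of _ "(e, 0)"] exI[of _ ?U] conjI ballI) blast+
qed

text \<open>
  For the lower bound the inequality for sums of norms is applied in each summand and the results
  are added. It is sharp when the centre has profile \<open>(mu, 0, 0, lam)\<close> and the weakly open set has
  profile close to \<open>(0, lam, mu, 0)\<close>, where \<open>mu + lam = 1\<close> and \<open>(mu, lam)\<close> lies on the line on
  which the two functionals that define the norm agree: each summand then contributes
  \<open>N_st s t (mu, lam) = (1 - s * t) / (2 - s - t)\<close>.
\<close>
theorem thickness_l1_sum_daugavet_N_st: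
  fixes X :: "'d::banach \<times> 'd \<Rightarrow> real"
  assumes D: "daugavet_property TYPE('d)" "(UNIV :: 'd set) \<noteq> {0}"
    and X_def: "X = norm_sum (N_st s t) norm norm"
  shows "thickness (norm_sum1 X X) = 2 * (1 - s * t) / (2 - s - t)"
proof -
  let ?N = "N_st s t"
  note N = N_st_absolute_normalised_norm[OF st]
  have X: "is_norm X" unfolding X_def by (intro is_norm_norm_sum N is_norm_norm)
  note nn = is_norm_nonneg[OF X]
  define Z where "Z = norm_sum l1_norm X X"
  have Z1: "norm_sum1 X X = Z" unfolding Z_def by (rule norm_sum1_eq_norm_sum[OF X X])
  have Z_Pair: "Z (x, y) = X x + X y" for x y by (simp add: Z_def l1_norm_nonneg_eq nn)
  define c where "c = (1 - s * t) / (2 - s - t)"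
  have c: "0 < c" using st st_less_1 by (simp add: c_def)
  have escapes_X: "escapes X l y x (c * (l + X x))" if "X y \<le> l" for l y x
    unfolding X_def
  proof (rule daugavet_sum_escapes[OF D N])
    show "norm_sum ?N norm norm y \<le> l" using that by (simp add: X_def)
    fix a b :: real assume "0 \<le> a" "0 \<le> b" "?N (a, b) = l"
    then have "c * (l + ?N (norm (fst x), norm (snd x))) \<le> ?N (a + norm (fst x), b + norm (snd x))"
      using N_st_add_ge[of a b "norm (fst x)" "norm (snd x)"] by (simp add: c_def)
    then show "c * (l + norm_sum ?N norm norm x) \<le> ?N (a + norm (fst x), b + norm (snd x))"
      by (cases x) simp
  qed
  have "thickness Z = 2 * c"
  proof (rule thickness_eqI)
    show "0 < 2 * c" using c by simp
    show "escapes Z 1 y x (2 * c)" if x: "Z x = 1" and y: "Z y \<le> 1" for x y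
    proof -
      obtain x1 x2 y1 y2 where xy: "x = (x1, x2)" "y = (y1, y2)" by (cases x, cases y)
      have y2: "X y2 \<le> 1 - X y1" using y by (simp add: xy Z_Pair)
      then have "0 \<le> 1 - X y1" using nn[of y2] by linarith
      note pos = nn[of y1] this nn[of x1] nn[of x2] c
      have "escapes Z (l1_norm (X y1, 1 - X y1)) (y1, y2) (x1, x2)
          (l1_norm (c * (X y1 + X x1), c * (1 - X y1 + X x2)))"
        unfolding Z_def using pos
        by (intro escapes_norm_sum[OF l1_norm_absolute_normalised X X] escapes_X y2) simp_all
      moreover have "l1_norm (X y1, 1 - X y1) = 1"
        using pos by (simp add: l1_norm_nonneg_eq)
      moreover have "l1_norm (c * (X y1 + X x1), c * (1 - X y1 + X x2)) = c * (1 + Z x)"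
      proof -
        have "0 \<le> c * (X y1 + X x1)" "0 \<le> c * (1 - X y1 + X x2)" using pos by simp_all
        then show ?thesis
          by (simp only: l1_norm_nonneg_eq) (simp add: xy Z_Pair algebra_simps)
      qed
      ultimately show ?thesis using x by (simp add: xy mult.commute)
    qed
    obtain v :: 'd where "v \<noteq> 0" using D(2) by (metis UNIV_eq_I singleton_iff)
    then obtain e :: 'd where e: "norm e = 1" by (metis norm_sgn)
    obtain f where f: "linear f" "\<And>v. \<bar>f v\<bar> \<le> norm v" "f e = 1"
      using norming_functional[of e] e by auto
    have df: "dual_functional norm f"
      unfolding dual_functional_norm by (rule bounded_linear_norm_bound[OF f(1,2)])
    define lam where "lam = (1 - s) / (2 - s - t)"
    define mu where "mu = (1 - t) / (2 - s - t)"
    have lm: "0 < lam" "0 < mu" "lam + mu = 1"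
      using st by (simp_all add: lam_def mu_def flip: add_divide_distrib)
    have "s * mu + lam = c" "mu + t * lam = c"
      using st by (simp_all add: lam_def mu_def c_def field_simps)
    then have N_lm: "?N (mu, lam) = c" using lm by (simp add: N_st_nonneg_eq)
    fix \<epsilon> :: real assume \<epsilon>: "0 < \<epsilon>"
    \<comment> \<open>The components that should vanish satisfy \<open>s * norm p1 < 2 * \<delta>\<close> and \<open>t * norm q2 < 2 * \<delta>\<close>; since
      \<open>s < t\<close>, this choice makes both norms smaller than \<open>\<epsilon> / 4\<close>.\<close>
    define \<delta> where "\<delta> = s * \<epsilon> / 8"
    have \<delta>: "0 < \<delta>" "\<delta> \<le> \<epsilon> / 8" "2 * \<delta> \<le> s * (\<epsilon> / 4)" "2 * \<delta> \<le> t * (\<epsilon> / 4)"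
      using st \<epsilon> by (auto simp: \<delta>_def)
    let ?x = "((mu *\<^sub>R e, 0), (0, lam *\<^sub>R e))" and ?w = "((0, lam *\<^sub>R e), (mu *\<^sub>R e, 0))"
    let ?U1 = "{z. lam - \<delta> < f (snd (fst z))}" and ?U2 = "{z. mu - \<delta> < f (fst (snd z))}"
    have dX: "dual_functional X (\<lambda>z. f (fst z))" "dual_functional X (\<lambda>z. f (snd z))"
      unfolding X_def
      by (rule dual_functional_fst[OF N is_norm_norm is_norm_norm df]
          dual_functional_snd[OF N is_norm_norm is_norm_norm df])+
    have "Z ?w = 1"
      using e lm by (simp add: Z_Pair X_def normalised_axes[OF N(1,3)])
    have "Z ?x = 1"
      using e lm by (simp add: Z_Pair X_def normalised_axes[OF N(1,3)])
    moreover have "openin (weak_topology Z) (?U1 \<inter> ?U2)"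
      unfolding Z_def
      by (intro openin_Int weakly_open_halfspace
          dual_functional_fst[OF l1_norm_absolute_normalised X X dX(2)]
          dual_functional_snd[OF l1_norm_absolute_normalised X X dX(1)])
    moreover have "?w \<in> unit_ball Z \<inter> (?U1 \<inter> ?U2)"
      using \<open>Z ?w = 1\<close> f(3) \<delta> by (simp add: unit_ball_def linear_scale[OF f(1)])
    moreover have "Z (y - ?x) \<le> 2 * c + \<epsilon>" if "y \<in> unit_ball Z \<inter> (?U1 \<inter> ?U2)" for y
    proof -
      obtain p1 q1 p2 q2 where y: "y = ((p1, q1), (p2, q2))"
        by (metis surj_pair)
      have near: "lam - \<delta> < norm q1" "mu - \<delta> < norm p2"
        using that f(2)[of q1] f(2)[of p2] unfolding y by auto
      have "?N (norm p1, norm q1) + ?N (norm p2, norm q2) \<le> 1"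
        using that by (simp add: y unit_ball_def Z_Pair X_def)
      then have ball: "s * norm p1 + norm q1 + (norm p2 + t * norm q2) \<le> 1"
        by (simp add: N_st_nonneg_eq)
      have "0 \<le> s * norm p1" "0 \<le> t * norm q2" using st by simp_all
      then have "s * norm p1 < 2 * \<delta>" "t * norm q2 < 2 * \<delta>"
        and q1: "norm q1 \<le> lam + \<delta>" and p2: "norm p2 \<le> mu + \<delta>"
        using ball near lm(3) by linarith+
      then have "s * norm p1 < s * (\<epsilon> / 4)" "t * norm q2 < t * (\<epsilon> / 4)"
        using \<delta>(3,4) by linarith+
      then have "norm p1 < \<epsilon> / 4" "norm q2 < \<epsilon> / 4"
        using st by (simp_all only: mult_less_cancel_left_pos)
      then have "norm (p1 - mu *\<^sub>R e) \<le> mu + \<epsilon> / 4" "norm (q2 - lam *\<^sub>R e) \<le> lam + \<epsilon> / 4"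
        using norm_triangle_ineq4[of p1 "mu *\<^sub>R e"] norm_triangle_ineq4[of q2 "lam *\<^sub>R e"] e lm
        by simp_all
      then have "?N (norm (p1 - mu *\<^sub>R e), norm q1) \<le> ?N (mu, lam) + \<epsilon> / 4 + \<delta>"
        "?N (norm p2, norm (q2 - lam *\<^sub>R e)) \<le> ?N (mu, lam) + \<delta> + \<epsilon> / 4"
        using q1 p2 \<delta>(1) \<epsilon> by (auto intro!: absolute_norm_perturb[OF N])
      then show ?thesis
        using \<delta>(2) \<epsilon> by (simp add: y Z_Pair X_def N_lm)
    qed
    ultimately show "\<exists>x U. Z x = 1 \<and> openin (weak_topology Z) U \<and> unit_ball Z \<inter> U \<noteq> {}
        \<and> (\<forall>y \<in> unit_ball Z \<inter> U. Z (y - x) \<le> 2 * c + \<epsilon>)"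
      by (intro exI[of _ ?x] exI[of _ "?U1 \<inter> ?U2"] conjI ballI) blast+
  qed
  then show ?thesis by (simp add: Z1 c_def)
qed

lemma l1_thickness_less: "2 * (1 - s * t) / (2 - s - t) < 1 + t"
proof -
  have "0 < (t - s) * (1 - t)" using st by simp
  then show ?thesis using st by (simp add: pos_divide_less_eq algebra_simps)
qed

end

theorem theorem3p4:
  fixes s t :: real
    and N :: "real \<times> real \<Rightarrow> real"
    and X :: "'d::banach \<times> 'd \<Rightarrow> real"
  assumes "0 < s" and "s < t" and "t < 1"
    and "N = N_st s t"
    and "(UNIV :: 'd set) \<noteq> {0}"
    and "daugavet_property TYPE('d)"
    and "X = norm_sum N norm norm"
  shows "thickness X = 1 + t
    \<and> thickness (norm_sum1 X X) = 2 * (1 - s * t) / (2 - s - t)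
    \<and> thickness (norm_sum1 X X) < thickness X"
  using thickness_daugavet_N_st[OF assms(1-3,6,5)]
    thickness_l1_sum_daugavet_N_st[OF assms(1-3,6,5), of X] l1_thickness_less[OF assms(1-3)]
    assms(4,7) by simp

end
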